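(* Let $f:\mathbb{R}_{\ge 0}\to\mathbb{R}_{\ge 0}$ be a non-decreasing càdlàg function with $f(0)=0$. Let $(x^f(t),t\ge 0)$ be a TASEP with wall constraint $x^f_1(t)\le f(t)$ for all $t\ge 0$, started from a (random or deterministic) initial condition $x^f_n(0)=x^f_n$, $n\in\mathbb{N}$, with a rightmost particle at $x^f_1\le 0$. Let $(x(t),t\ge 0)$ be a TASEP with step initial condition, without wall constraint, independent of $\{x^f_n,n\in\mathbb{N}\}$. Let $T\ge 0$. Then for any $n\in\mathbb{N}$ and every integer $s$, $$\mathbb{P}\bigl(x^f_n(T)>s\bigr)=\mathbb{P}\Bigl(x_n(t)>s-f(T-t)\ \ \forall t\in[0,T],\quad x_{n-j}(T)>s-x^f_{1+j}\ \ \forall j\in\{0,\dots,n-1\}\Bigr).$$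
   Context: $\mathbb{N}=\{1,2,\dots\}$. TASEP (continuous time, single species, on $\mathbb{Z}$): each site holds at most one particle; each particle attempts to jump one step to the right after exponential waiting times with rate one, the waiting times of different particles being independent of one another; a jump succeeds only if the target site is empty. Particles are labelled from right to left, $\cdots<x_{n+1}(t)<x_n(t)<\cdots$, and $x_n(t)$ is the position at time $t$ of the particle with label $n$. TASEP with wall $f$: the same dynamics, with a rightmost particle (label $1$), in front of which a wall located at $f(t)$ at time $t$ moves deterministically to the right and prevents any jumps across it, so that $x^f_1(t)\le f(t)$ for all $t\ge 0$. Step initial condition: $x_n(0)=-(n-1)$ for $n\in\mathbb{N}$.
   Formalization: In the right-hand event f(T-t) is replaced by its integer part ⌊f(T-t)⌋; with f(T-t) itself the identity fails when f takes non-integer values (e.g. n=1, s=0, T=1, f=0 before time 1/2 and 1/2 afterwards), and for integer-valued f the two agree. *)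

theory Defs
  imports "HOL-Probability.Probability"
begin

definition cadlag :: "(real \<Rightarrow> 'b::topological_space) \<Rightarrow> bool" where
  "cadlag g \<longleftrightarrow>
     (\<forall>t\<ge>0. continuous (at_right t) g) \<and> (\<forall>t>0. \<exists>l. (g \<longlongrightarrow> l) (at_left t))"

text \<open>
  \<open>prob_space.indep_var\<close> needs both random variables to have the same type; this is the same
  notion for different types.
\<close>

definition indep_rvs ::
  "'a measure \<Rightarrow> 'b measure \<Rightarrow> ('a \<Rightarrow> 'b) \<Rightarrow> 'c measure \<Rightarrow> ('a \<Rightarrow> 'c) \<Rightarrow> bool" where
  "indep_rvs M M1 Y M2 Z \<longleftrightarrow>
     Y \<in> measurable M M1 \<and> Z \<in> measurable M M2 \<and>
     prob_space.indep_set M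
       {Y -` B \<inter> space M | B. B \<in> sets M1} {Z -` B \<inter> space M | B. B \<in> sets M2}"

text \<open>
  Particles carry the labels \<open>1, 2, \<dots>\<close>; label \<open>0\<close> is never used. \<open>W n k\<close> is the time that
  particle \<open>n\<close> waits between its \<open>k\<close>-th and its \<open>(k+1)\<close>-st attempt to jump, whether or not
  these attempts succeed.
\<close>

definition waiting_times :: "'a measure \<Rightarrow> (nat \<Rightarrow> nat \<Rightarrow> 'a \<Rightarrow> real) \<Rightarrow> bool" where
  "waiting_times M W \<longleftrightarrow>
     prob_space.indep_vars M (\<lambda>_. borel) (\<lambda>(n, k). W n k) ({1..} \<times> UNIV) \<and>
     (\<forall>n\<ge>1. \<forall>k. distributed M lborel (W n k) (exponential_density 1))"

definition attempt_times :: "(nat \<Rightarrow> real) \<Rightarrow> real set" where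
  "attempt_times w = range (\<lambda>k. \<Sum>i\<le>k. w i)"

text \<open>
  \<open>A n\<close> is the set of attempt times of particle \<open>n\<close>, \<open>x n t\<close> its position at time \<open>t\<close>, and
  \<open>allowed t y\<close> says whether a jump to site \<open>y\<close> at time \<open>t\<close> is permitted (apart from exclusion).
  The configuration just before time \<open>t\<close> is expressed by \<open>eventually \<dots> (at_left t)\<close>. The particles
  relevant to a given jump have piecewise constant paths, so this refers to their left limits.
\<close>

definition tasep_evolution ::
  "(real \<Rightarrow> int \<Rightarrow> bool) \<Rightarrow> (nat \<Rightarrow> real set) \<Rightarrow> (nat \<Rightarrow> real \<Rightarrow> int) \<Rightarrow> bool" where
  "tasep_evolution allowed A x \<longleftrightarrow>
     (\<forall>n\<ge>1.
        (\<forall>s t. 0 \<le> s \<and> s \<le> t \<and> A n \<inter> {s<..t} = {} \<longrightarrow> x n t = x n s) \<and>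
        (\<forall>t\<in>A n. \<forall>\<^sub>F s in at_left t.
           x n t = (if (\<forall>m\<ge>1. x m s \<noteq> x n s + 1) \<and> allowed t (x n s + 1)
                    then x n s + 1 else x n s)))"

definition initial_config :: "(nat \<Rightarrow> real \<Rightarrow> 'a \<Rightarrow> int) \<Rightarrow> 'a \<Rightarrow> nat \<Rightarrow> int" where
  "initial_config X \<omega> = (\<lambda>n\<in>{1..}. X n 0 \<omega>)"

definition trajectories :: "(nat \<Rightarrow> real \<Rightarrow> 'a \<Rightarrow> int) \<Rightarrow> 'a \<Rightarrow> nat \<times> real \<Rightarrow> int" where
  "trajectories X \<omega> = (\<lambda>(n, t)\<in>{1..} \<times> {0..}. X n t \<omega>)"

text \<open>
  Ordering is only required of the initial configuration, since the evolution preserves it.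
\<close>

definition tasep_process ::
  "(real \<Rightarrow> int \<Rightarrow> bool) \<Rightarrow> 'a measure \<Rightarrow> (nat \<Rightarrow> real \<Rightarrow> 'a \<Rightarrow> int) \<Rightarrow> bool" where
  "tasep_process allowed M X \<longleftrightarrow>
     (\<forall>n\<ge>1. \<forall>t\<ge>0. X n t \<in> measurable M (count_space UNIV)) \<and>
     (\<forall>n\<ge>1. \<forall>\<omega>\<in>space M. cadlag (\<lambda>t. X n t \<omega>)) \<and>
     (AE \<omega> in M. \<forall>n\<ge>1. X (n + 1) 0 \<omega> < X n 0 \<omega>) \<and>
     (\<exists>W. waiting_times M W \<and>
          indep_rvs M
            (PiM {1..} (\<lambda>_. count_space UNIV)) (initial_config X)
            (PiM ({1..} \<times> UNIV) (\<lambda>_. borel)) (\<lambda>\<omega>. \<lambda>(n, k)\<in>{1..} \<times> UNIV. W n k \<omega>) \<and>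
          (AE \<omega> in M. tasep_evolution allowed
             (\<lambda>n. attempt_times (\<lambda>k. W n k \<omega>)) (\<lambda>n t. X n t \<omega>)))"

definition tasep :: "'a measure \<Rightarrow> (nat \<Rightarrow> real \<Rightarrow> 'a \<Rightarrow> int) \<Rightarrow> bool" where
  "tasep = tasep_process (\<lambda>t y. True)"

text \<open>
  A jump to site \<open>y\<close> at time \<open>t\<close> does not cross the wall iff \<open>y \<le> f t\<close>. If \<open>f\<close> is non-decreasing
  and \<open>X 1 0 \<le> f 0\<close> holds almost surely, then almost surely \<open>X 1 t \<le> f t\<close> for all \<open>t \<ge> 0\<close>.
  As positions are integers, the wall acts as if it were located at \<open>\<lfloor>f t\<rfloor>\<close>.
\<close>

definition tasep_with_wall ::
  "(real \<Rightarrow> real) \<Rightarrow> 'a measure \<Rightarrow> (nat \<Rightarrow> real \<Rightarrow> 'a \<Rightarrow> int) \<Rightarrow> bool" where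
  "tasep_with_wall f = tasep_process (\<lambda>t y. real_of_int y \<le> f t)"

definition step_initial :: "'a measure \<Rightarrow> (nat \<Rightarrow> real \<Rightarrow> 'a \<Rightarrow> int) \<Rightarrow> bool" where
  "step_initial M X \<longleftrightarrow> (AE \<omega> in M. \<forall>n\<ge>1. X n 0 \<omega> = - (int n - 1))"

end

(*
  Divide [0, T] into N cells and, for large N, replace the dynamics by a discrete one in which the
  particles 1, ..., n attempt to jump at most once per cell. Attach to the free system the attempts
  of the walled system with time and labels reversed (label m becomes n + 1 - m). Then
    "x_k(T - t) + x^f_(n+1-k)(t) > s for all k, and x_n(u) + f(T - u) > s for all u < T - t"
  does not depend on t: when one attempt is moved across, the exclusion rule of either system is
  implied by the neighbouring inequalities. At t = 0 this is the event on the right-hand side and at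
  t = T it says x^f_n(T) > s, so the two events coincide for each realisation of the attempts. The
  probabilities agree because the set of cells containing attempts has a reversible law; this law is
  determined by the probabilities exp(-h * #J) that no attempt falls into the cells J of length h.
*)
theory Submission
  imports Defs
begin

section \<open>Discrete duality\<close>

text \<open>The processes are given by waiting times, and this renewal description does not show
  that the jump attempts in [0, T] look the same backwards. Recording only which cells are hit
  leaves one task: an avoidance formula that sees nothing but the number of cells. It is obtained
  from sums of exponential variables by following, from one sum to the next, the chance that all
  later sums avoid the cells.

  The two systems share a probability space, but nothing is known about the joint law of their
  waiting times, so they cannot be coupled. The duality is applied to the free system's own attempts
  and their reflection; the walled system is reached by comparing laws. This requires a constant
  initial configuration \<open>c\<close>. Hence the events are split by the initial positions of
  labels 1 to \<open>n\<close>, which is countably many cases; particles behind label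
  \<open>n\<close> never influence it.

  The condition on the free path for all t in [0, T] is not an event of the product sigma-algebra on
  trajectories when T > 0, so independence is used at grid times, before the limit.\<close>

definition jump :: "(int \<Rightarrow> bool) \<Rightarrow> nat \<Rightarrow> (nat \<Rightarrow> int) \<Rightarrow> nat \<Rightarrow> int" where
  "jump ok m X =
     (if ok (X m + 1) \<and> (m = 1 \<or> X (m - 1) \<noteq> X m + 1) then X(m := X m + 1) else X)"

text \<open>
  Step \<open>p\<close> belongs to label \<open>p mod n + 1\<close> in cell \<open>p div n\<close>. Within a cell the labels are updated in
  increasing order, so that reversing the steps also reverses the labels.
\<close>

primrec run ::
  "nat \<Rightarrow> (nat \<Rightarrow> int \<Rightarrow> bool) \<Rightarrow> nat set \<Rightarrow> (nat \<Rightarrow> int) \<Rightarrow> nat \<Rightarrow> nat \<Rightarrow> int" where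
  "run n ok S c 0 = c"
| "run n ok S c (Suc p) =
     (if p \<in> S then jump (ok (p div n)) (p mod n + 1) (run n ok S c p) else run n ok S c p)"

text \<open>Labels above \<open>n\<close> are left out because \<open>run\<close> with n > 0 never
  moves them. Under this ordering the only label up to \<open>n\<close> that can occupy the site
  ahead of particle m is m - 1, which is why \<open>jump\<close> tests no other.\<close>

definition packed :: "nat \<Rightarrow> (nat \<Rightarrow> int) \<Rightarrow> bool" where
  "packed n X \<longleftrightarrow> (\<forall>m\<in>{1..<n}. X (m + 1) < X m)"

lemma packed_jump:
  assumes "packed n X"
  shows "packed n (jump ok m X)"
  unfolding packed_def
proof
  fix j assume j: "j \<in> {1..<n}"
  have "X (j + 1) < X j" using assms j by (auto simp: packed_def)
  then show "jump ok m X (j + 1) < jump ok m X j"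
    using j by (auto simp: jump_def)
qed

lemma packed_run: "packed n c \<Longrightarrow> packed n (run n ok S c p)"
  by (induction p) (auto simp: packed_jump)

lemma run_wall_le:
  assumes "mono g" "c 1 \<le> g 0"
  shows "run n (\<lambda>i y. y \<le> g i) S c p 1 \<le> g (p div n)"
proof (induction p)
  case 0
  then show ?case using assms by simp
next
  case (Suc p)
  have "g (p div n) \<le> g (Suc p div n)"
    by (intro monoD[OF assms(1)] div_le_mono) simp
  with Suc show ?case by (auto simp: jump_def)
qed

text \<open>Each of the n - m gaps is at least one. At the end of \<open>run_duality\<close> the
  step configuration 1 - k takes away exactly this slack, so the inequality for label
  \<open>n\<close> implies all the others.\<close>

lemma packed_le:
  assumes "packed n X" "1 \<le> m" "m \<le> n"
  shows "X n + (int n - int m) \<le> X m"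
  using assms(3,2)
proof (induction m rule: inc_induct)
  case base then show ?case by simp
next
  case (step m)
  have "X (m + 1) < X m" using assms(1) step by (auto simp: packed_def)
  with step show ?case by simp
qed

text \<open>Subtracting p from N * n - 1 complements both base-n digits of p without any borrowing.
  Thus one reflection of the step number reverses the cells and, within each cell, the
  labels.\<close>

lemma reflect_mod:
  fixes n N p :: nat
  assumes "p < N * n"
  shows "(N * n - Suc p) mod n = n - 1 - p mod n" "(N * n - Suc p) div n = N - 1 - p div n"
proof -
  have n: "0 < n" using assms by (cases n) auto
  have pd: "p div n < N" using assms by (simp add: less_mult_imp_div_less)
  have "p = (p div n) * n + p mod n" by simp
  moreover have "N * n = (N - 1 - p div n) * n + (p div n) * n + n"
  proof -
    obtain d where "N = Suc (p div n) + d" using pd by (metis less_eq_Suc_le le_iff_add)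
    then show ?thesis by (simp add: algebra_simps)
  qed
  ultimately have "N * n - Suc p = (N - 1 - p div n) * n + (n - 1 - p mod n)"
    using mod_less_divisor[OF n, of p] by linarith
  then show "(N * n - Suc p) mod n = n - 1 - p mod n" "(N * n - Suc p) div n = N - 1 - p div n"
    using n by auto
qed

text \<open>The wall acts like a particle one site beyond \<open>g\<close>: label 1 moves to the
  minimum of X 1 + 1 and \<open>g\<close>, just as label m moves to the minimum of X m + 1 and X (m
  - 1) - 1. The wall inequality concerns label \<open>n\<close> of the free system because label 1,
  the only one that the wall can stop, is paired with it. One such inequality is traded for every
  step moved across, hence the quantifier over p < K.\<close>

theorem run_duality:
  fixes n N :: nat and s :: int and g :: "nat \<Rightarrow> int"
  defines "K \<equiv> N * n"
  assumes n: "0 < n" and g: "mono g" "c 1 \<le> g 0" and c: "packed n c"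
    and S: "S' = (\<lambda>p. K - Suc p) ` S" "S \<subseteq> {..<K}"
  defines "X \<equiv> run n (\<lambda>i y. y \<le> g i) S c"
    and "x \<equiv> run n (\<lambda>i y. True) S' (\<lambda>m. 1 - int m)"
  shows "X K n > s \<longleftrightarrow>
    (\<forall>k\<in>{1..n}. x K k + c (n + 1 - k) > s) \<and>
    (\<forall>p<K. x p n + g (N - 1 - p div n) > s)"
proof -
  define E where "E p \<longleftrightarrow> (\<forall>k\<in>{1..n}. x (K - p) k + X p (n + 1 - k) > s) \<and>
    (\<forall>q<K - p. x q n + g (N - 1 - q div n) > s)" for p
  have pX: "packed n (X p)" for p unfolding X_def by (rule packed_run[OF c])
  have px: "packed n (x p)" for p unfolding x_def by (rule packed_run) (simp add: packed_def)
  have wX: "X p 1 \<le> g (p div n)" for p unfolding X_def by (rule run_wall_le) (use g in auto)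
  have step: "E p \<longleftrightarrow> E (Suc p)" if p: "p < K" for p
  proof -
    \<comment> \<open>Step \<open>p\<close> of the walled run mirrors step \<open>q\<close> of the
      free run; moving it across shortens the free run from \<open>Suc q\<close> to \<open>q\<close>
      steps.\<close>
    define q where "q = K - Suc p"
    have q: "K - p = Suc q" "K - Suc p = q" "q < K" using p by (auto simp: q_def)
    have qd: "N - 1 - q div n = p div n" and qm: "q mod n = n - 1 - p mod n"
    proof -
      have "p = K - Suc q" using p by (auto simp: q_def)
      then show "N - 1 - q div n = p div n" using reflect_mod(2)[of q N n] q by (simp add: K_def)
      show "q mod n = n - 1 - p mod n" using reflect_mod(1)[of p N n] p by (simp add: K_def q_def)
    qed
    have qS: "q \<in> S' \<longleftrightarrow> p \<in> S"
    proof
      assume "q \<in> S'"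
      then obtain r where "r \<in> S" "q = K - Suc r" using S by auto
      moreover then have "r < K" using S by auto
      ultimately have "r = p" using p by (auto simp: q_def)
      with \<open>r \<in> S\<close> show "p \<in> S" by simp
    qed (use S in \<open>auto simp: q_def\<close>)
    define m where "m = p mod n + 1"
    define k where "k = q mod n + 1"
    have mk: "m + k = n + 1" "1 \<le> m" "m \<le> n" "1 \<le> k" "k \<le> n"
      using n mod_less_divisor[OF n, of p] by (auto simp: m_def k_def qm)
    have E0: "E p \<longleftrightarrow> (\<forall>k\<in>{1..n}. x (Suc q) k + X p (n + 1 - k) > s) \<and>
        (\<forall>r<q. x r n + g (N - 1 - r div n) > s) \<and> x q n + g (p div n) > s"
      using qd by (auto simp: E_def q less_Suc_eq)
    have E1: "E (Suc p) \<longleftrightarrow> (\<forall>k\<in>{1..n}. x q k + X (Suc p) (n + 1 - k) > s) \<and>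
        (\<forall>r<q. x r n + g (N - 1 - r div n) > s)"
      by (auto simp: E_def q)
    have X1: "X (Suc p) 1 \<le> g (p div n)"
      using wX[of p] by (auto simp: X_def jump_def)
    \<comment> \<open>\<open>E p\<close> has one wall inequality more than \<open>E (Suc p)\<close>.
      It is recovered from the pair of label \<open>n\<close> and label 1, since label 1 is not
      beyond the wall.\<close>
    have last: "x q n + X (Suc p) 1 > s" if "E (Suc p)"
    proof -
      have "x q n + X (Suc p) (n + 1 - n) > s" using that n unfolding E1 by (metis Suc_leI atLeastAtMost_iff le_refl One_nat_def)
      then show ?thesis by simp
    qed
    show ?thesis
    proof (cases "p \<in> S")
      case False
      then have "X (Suc p) = X p" "x (Suc q) = x q" using qS by (auto simp: X_def x_def)
      then show ?thesis using E0 E1 last X1 by auto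
    next
      case True
      have Xs: "X (Suc p) = jump (\<lambda>y. y \<le> g (p div n)) m (X p)"
        using True by (simp add: X_def m_def)
      have xs: "x (Suc q) = jump (\<lambda>y. True) k (x q)"
        using True qS by (simp add: x_def k_def)
      have Xo: "X (Suc p) (n + 1 - j) = X p (n + 1 - j)" if "j \<noteq> k" "j \<in> {1..n}" for j
        using that mk by (auto simp: Xs jump_def)
      have xo: "x (Suc q) j = x q j" if "j \<noteq> k" for j
        using that by (auto simp: xs jump_def)
      have km: "n + 1 - k = m" using mk by simp
      \<comment> \<open>In an ordered configuration an obstructed jump is a minimum. For m other
        than 1 the wall test passes automatically, because X p m + 1 is at most X p (m - 1), which
        is at most the wall.\<close>
      have Xm: "X (Suc p) m = (if m = 1 then min (X p m + 1) (g (p div n)) else min (X p m + 1) (X p (m - 1) - 1))"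
      proof (cases "m = 1")
        case True
        then show ?thesis using wX[of p] by (auto simp: Xs jump_def)
      next
        case False
        then have "X p m < X p (m - 1)" using pX[of p] mk by (auto simp: packed_def dest!: bspec[of _ _ "m - 1"])
        moreover have "X p (m - 1) \<le> g (p div n)"
        proof -
          have "X p j \<le> X p 1" if "1 \<le> j" "j \<le> n" for j
            using that
          proof (induction j rule: dec_induct)
            case base show ?case by simp
          next
            case (step j)
            then show ?case using pX[of p] by (force simp: packed_def dest!: bspec[of _ _ j])
          qed
          note this[of "m - 1"]
          moreover have "1 \<le> m - 1" "m - 1 \<le> n" using False mk by auto
          ultimately show ?thesis using wX[of p] by simp
        qed
        ultimately show ?thesis using False by (auto simp: Xs jump_def)
      qed
      have xk: "x (Suc q) k = (if k = 1 then x q k + 1 else min (x q k + 1) (x q (k - 1) - 1))"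
      proof (cases "k = 1")
        case True
        then show ?thesis by (auto simp: xs jump_def)
      next
        case False
        then have "x q k < x q (k - 1)" using px[of q] mk by (auto simp: packed_def dest!: bspec[of _ _ "k - 1"])
        then show ?thesis using False by (auto simp: xs jump_def)
      qed
      show ?thesis
      proof
        assume L: "E p"
        have pr: "x (Suc q) j + X p (n + 1 - j) > s" if "j \<in> {1..n}" for j
          using L that unfolding E0 by auto
        \<comment> \<open>Only the pair (k, m) changes. The bound by X p m + 1 is compensated by the
          jump of \<open>k\<close> that is given up; the bound by the particle ahead of
          \<open>m\<close> is covered by the pair (k + 1, m - 1) and the ordering of the free
          system, and for m = 1 by the wall inequality contained in \<open>E p\<close>.\<close>
        have "x q k + X (Suc p) m > s"
        proof (cases "m = 1")
          case True
          then have "k = n" using mk by simp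
          then show ?thesis using pr[of k] mk km True xk Xm L unfolding E0 by (auto split: if_splits)
        next
          case False
          then have kn: "k + 1 \<in> {1..n}" "n + 1 - (k + 1) = m - 1" using mk by auto
          have "x q (k + 1) < x q k" using px[of q] kn mk by (auto simp: packed_def)
          with pr[OF kn(1)] xo[of "k + 1"] kn have "x q k + X p (m - 1) > s + 1" by simp
          moreover have "x q k + X p m + 1 > s" using pr[of k] mk km xk by (auto split: if_splits)
          ultimately show ?thesis using False Xm by auto
        qed
        then have "x q j + X (Suc p) (n + 1 - j) > s" if "j \<in> {1..n}" for j
          using pr[OF that] xo[of j] Xo[OF _ that] km by (cases "j = k") auto
        then show "E (Suc p)" using L unfolding E0 E1 by auto
      next
        assume R: "E (Suc p)"
        have pr: "x q j + X (Suc p) (n + 1 - j) > s" if "j \<in> {1..n}" for j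
          using R that unfolding E1 by auto
        have up: "x q k + X p m + 1 > s" using pr[of k] mk km Xm by (auto split: if_splits)
        \<comment> \<open>The mirror image: an obstruction of \<open>k\<close> by k - 1 is covered
          by the pair (k - 1, m + 1) and the ordering of the walled system. Label 1 of the free
          system meets no obstruction, so no wall inequality enters here.\<close>
        have "x (Suc q) k + X p m > s"
        proof (cases "k = 1")
          case True then show ?thesis using up xk by simp
        next
          case False
          then have kn: "k - 1 \<in> {1..n}" "n + 1 - (k - 1) = m + 1" "k - 1 \<noteq> k" using mk by auto
          have "X p (m + 1) < X p m" using pX[of p] kn mk False by (auto simp: packed_def)
          moreover have "x q (k - 1) + X p (m + 1) > s" using pr[OF kn(1)] Xo[OF kn(3,1)] kn by simp
          ultimately show ?thesis using False xk up by auto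
        qed
        then have "x (Suc q) j + X p (n + 1 - j) > s" if "j \<in> {1..n}" for j
          using pr[OF that] xo[of j] Xo[OF _ that] km by (cases "j = k") auto
        moreover have "x q n + g (p div n) > s" using last[OF R] X1 by simp
        ultimately show "E p" using R unfolding E0 E1 by auto
      qed
    qed
  qed
  have "E 0 \<longleftrightarrow> E p" if "p \<le> K" for p
    using that by (induction p) (auto simp: step)
  then have "E 0 \<longleftrightarrow> E K" by simp
  also have "E K \<longleftrightarrow> X K n > s"
  proof
    assume "E K"
    moreover have "1 \<in> {1..n}" using n by simp
    ultimately have "x 0 1 + X K (n + 1 - 1) > s" unfolding E_def diff_self_eq_0 by blast
    then show "X K n > s" by (simp add: x_def)
  next
    assume *: "X K n > s"
    have "x 0 k + X K (n + 1 - k) > s" if "k \<in> {1..n}" for k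
      proof -
      have "X K n + (int n - int (n + 1 - k)) \<le> X K (n + 1 - k)"
        using that by (intro packed_le[OF pX]) auto
      moreover have "int n - int (n + 1 - k) = int k - 1" using that by auto
      ultimately show ?thesis using * by (simp add: x_def)
    qed
    then show "E K" by (auto simp: E_def)
  qed
  finally show ?thesis by (auto simp: E_def X_def)
qed

section \<open>Evolution along a grid\<close>

text \<open>The update rule of \<open>tasep_evolution\<close> with the left limit at t replaced by
  one earlier time s. As the rule holds eventually on the left of t, such a time exists after any
  prescribed one.\<close>

definition evolution_step ::
  "(real \<Rightarrow> int \<Rightarrow> bool) \<Rightarrow> (nat \<Rightarrow> real \<Rightarrow> int) \<Rightarrow> nat \<Rightarrow> real \<Rightarrow> real \<Rightarrow> bool" where
  "evolution_step allowed x m s t \<longleftrightarrow>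
     x m t = (if (\<forall>j\<ge>1. x j s \<noteq> x m s + 1) \<and> allowed t (x m s + 1) then x m s + 1 else x m s)"

lemma evolution_const:
  assumes "tasep_evolution allowed A x" "1 \<le> m" "0 \<le> s" "s \<le> t" "A m \<inter> {s<..t} = {}"
  shows "x m t = x m s"
  using assms unfolding tasep_evolution_def by blast

lemma evolution_attempt:
  assumes "tasep_evolution allowed A x" "1 \<le> m" "t \<in> A m" "s < t"
  obtains u where "s < u" "u < t" "evolution_step allowed x m u t"
proof -
  have "\<forall>\<^sub>F u in at_left t. evolution_step allowed x m u t"
    using assms unfolding tasep_evolution_def evolution_step_def by blast
  moreover have "\<forall>\<^sub>F u in at_left t. u \<in> {s<..<t}"
    using assms(4) by (rule eventually_at_left_real)
  ultimately have "\<forall>\<^sub>F u in at_left t. evolution_step allowed x m u t \<and> u \<in> {s<..<t}"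
    by (rule eventually_conj)
  then have "\<exists>u. evolution_step allowed x m u t \<and> u \<in> {s<..<t}"
    by (rule eventually_happens'[OF trivial_limit_at_left_real])
  then show thesis using that by auto
qed

text \<open>Supplies an induction on the number of attempts of a single particle: \<open>u\<close>
  precedes the last attempt \<open>r\<close>, so fewer attempts lie in (s, u] than in (s,
  t].\<close>

lemma last_attempt:
  assumes ev: "tasep_evolution allowed A x" and m: "1 \<le> m"
    and s: "0 \<le> s" and ne: "A m \<inter> {s<..t} \<noteq> {}" and fin: "finite (A m \<inter> {s<..t})"
  obtains u r where "s < u" "u < r" "r \<le> t" "r \<in> A m" "x m t = x m r"
    "evolution_step allowed x m u r" "card (A m \<inter> {s<..u}) < card (A m \<inter> {s<..t})"
proof -
  define r where "r = Max (A m \<inter> {s<..t})"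
  have r: "r \<in> A m \<inter> {s<..t}" unfolding r_def using fin ne by (rule Max_in)
  have mx: "y \<le> r" if "y \<in> A m \<inter> {s<..t}" for y
    unfolding r_def using fin that by (rule Max_ge)
  have "A m \<inter> {r<..t} = {}" using mx r by fastforce
  then have "x m t = x m r" using evolution_const[OF ev m, of r t] r s by auto
  moreover obtain u where u: "s < u" "u < r" "evolution_step allowed x m u r"
    using evolution_attempt[OF ev m, of r s] r by auto
  moreover have "card (A m \<inter> {s<..u}) < card (A m \<inter> {s<..t})"
  proof (intro psubset_card_mono fin psubsetI)
    show "A m \<inter> {s<..u} \<noteq> A m \<inter> {s<..t}" using r u by (metis IntD2 greaterThanAtMost_iff not_le)
  qed (use r u in auto)
  ultimately show thesis using that[of u r] r by auto
qed

lemma evolution_mono: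
  assumes ev: "tasep_evolution allowed A x" and m: "1 \<le> m" and "0 \<le> s" "s \<le> t"
    and "finite (A m \<inter> {s<..t})"
  shows "x m s \<le> x m t"
  using assms(4,5)
proof (induction "card (A m \<inter> {s<..t})" arbitrary: t rule: less_induct)
  case less
  show ?case
  proof (cases "A m \<inter> {s<..t} = {}")
    case True
    then show ?thesis using evolution_const[OF ev m assms(3) less.prems(1)] by simp
  next
    case False
    obtain u r where *: "s < u" "u < r" "r \<le> t" "x m t = x m r"
      "evolution_step allowed x m u r" "card (A m \<inter> {s<..u}) < card (A m \<inter> {s<..t})"
      using last_attempt[OF ev m assms(3) False less.prems(2)] by metis
    have "x m s \<le> x m u"
      using * by (intro less.hyps) (auto intro: finite_subset[OF _ less.prems(2)])
    also have "\<dots> \<le> x m t" using *(4,5) by (simp add: evolution_step_def split: if_splits)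
    finally show ?thesis .
  qed
qed

text \<open>Induction on the attempts of the rear particle alone. At its last attempt the exclusion
  rule keeps it behind the position that the front particle had just before, and the front particle
  never moves back.\<close>

lemma evolution_order:
  assumes ev: "tasep_evolution allowed A x" and m: "1 \<le> m"
    and fin: "\<And>j t. 1 \<le> j \<Longrightarrow> finite (A j \<inter> {0<..t})"
    and init: "x (m + 1) 0 < x m 0" and "0 \<le> t"
  shows "x (m + 1) t < x m t"
  using assms(5)
proof (induction "card (A (m + 1) \<inter> {0<..t})" arbitrary: t rule: less_induct)
  case less
  have mono: "x m s \<le> x m t" if "0 \<le> s" "s \<le> t" for s
    using that by (intro evolution_mono[OF ev m] finite_subset[OF _ fin[OF m, of t]]) auto
  show ?case
  proof (cases "A (m + 1) \<inter> {0<..t} = {}")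
    case True
    then have "x (m + 1) t = x (m + 1) 0"
      using evolution_const[OF ev _ order_refl less.prems] by simp
    also have "\<dots> < x m t" using init mono[of 0] less.prems by simp
    finally show ?thesis .
  next
    case False
    obtain u r where *: "0 < u" "u < r" "r \<le> t" "x (m + 1) t = x (m + 1) r"
      "evolution_step allowed x (m + 1) u r"
      "card (A (m + 1) \<inter> {0<..u}) < card (A (m + 1) \<inter> {0<..t})"
      using last_attempt[OF ev _ order_refl False fin] by (metis le_add2)
    have "x (m + 1) u < x m u" using * by (intro less.hyps) auto
    then have "x (m + 1) r < x m u"
      using *(5) m by (auto simp: evolution_step_def split: if_splits)
    with * mono[of u] show ?thesis by simp
  qed
qed

text \<open>Cells are open on the left and closed on the right, like the intervals without attempts
  in \<open>tasep_evolution\<close>, so N cells of length T / N tile (0, T] for T > 0 and N >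
  0.\<close>

definition grid_cell :: "real \<Rightarrow> nat \<Rightarrow> real set" where
  "grid_cell h i = {real i * h<..real (Suc i) * h}"

text \<open>The index p stands for label p mod n + 1 in cell p div n, as in \<open>run\<close>, so
  this set can be passed to \<open>run\<close> directly. It forgets how many attempts a cell
  contains and where they lie.\<close>

definition attempted_cells :: "nat \<Rightarrow> nat \<Rightarrow> real \<Rightarrow> (nat \<Rightarrow> real set) \<Rightarrow> nat set" where
  "attempted_cells n N h A = {p. p < N * n \<and> A (p mod n + 1) \<inter> grid_cell h (p div n) \<noteq> {}}"

text \<open>With at most one attempt per cell among all labels up to \<open>n\<close>, the order in
  which \<open>run\<close> serves the labels inside a cell does not matter.\<close>

definition attempts_separated :: "nat \<Rightarrow> nat \<Rightarrow> real \<Rightarrow> (nat \<Rightarrow> real set) \<Rightarrow> bool" where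
  "attempts_separated n N h A \<longleftrightarrow>
     (\<forall>i<N. \<forall>m\<in>{1..n}. \<forall>m'\<in>{1..n}. \<forall>t\<in>A m \<inter> grid_cell h i. \<forall>t'\<in>A m' \<inter> grid_cell h i.
        m = m' \<and> t = t')"

text \<open>At most one label attempts in the cell and all others up to \<open>n\<close> stay put,
  so serving the labels one by one passes only through the configurations at the two ends of the
  cell.\<close>

lemma run_eq_evolution_in_cell:
  assumes ev: "tasep_evolution allowed A x" and h: "0 \<le> h"
    and order: "\<forall>m\<ge>1. \<forall>t\<ge>0. x (m + 1) t < x m t"
    and sepa: "attempts_separated n N h A"
    and oka: "\<forall>i<N. \<forall>m\<in>{1..n}. \<forall>t\<in>A m \<inter> grid_cell h i. allowed t = ok i"
    and i: "i < N"
    and start: "\<forall>m\<in>{1..n}.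
      run n ok (attempted_cells n N h A) c (i * n) m = x m (real i * h)"
  shows "r \<le> n \<Longrightarrow> m \<in> {1..n} \<Longrightarrow> run n ok (attempted_cells n N h A) c (i * n + r) m =
     (if m \<le> r then x m (real (Suc i) * h) else x m (real i * h))"
proof (induction r arbitrary: m)
  case 0
  then show ?case using start by simp
next
  case (Suc r)
  let ?s = "real i * h" and ?t = "real (Suc i) * h"
  let ?S = "attempted_cells n N h A"
  note sep = sepa[unfolded attempts_separated_def, rule_format]
  have ok: "allowed t y \<longleftrightarrow> ok i y" if "t \<in> A m \<inter> grid_cell h i" "m \<in> {1..n}" for m t y
    using oka i that by metis
  have st: "0 \<le> ?s" "?s \<le> ?t" using h by (auto simp: mult_right_mono)
  have unchanged: "x l ?t = x l ?s" if "1 \<le> l" "A l \<inter> grid_cell h i = {}" for l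
    using that st by (intro evolution_const[OF ev]) (auto simp: grid_cell_def)
  have decr: "x k t < x l t" if "1 \<le> l" "l < k" "0 \<le> t" for k l t
    using that(2)
  proof (induction k)
    case (Suc k)
    then show ?case using order[rule_format, of k t] order[rule_format, of l t] that by (cases "k = l") auto
  qed simp
  define l where "l = Suc r"
  have l: "1 \<le> l" "l \<le> n" "l \<in> {1..n}" using Suc.prems by (auto simp: l_def)
  have p: "(i * n + r) div n = i" "(i * n + r) mod n = r" using Suc.prems by auto
  have "i * n + r < Suc i * n" using Suc.prems by simp
  also have "\<dots> \<le> N * n" using i by (intro mult_le_mono1) simp
  finally have pS: "i * n + r \<in> ?S \<longleftrightarrow> A l \<inter> grid_cell h i \<noteq> {}"
    unfolding attempted_cells_def using p by (simp add: l_def)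
  have IH: "run n ok ?S c (i * n + r) k = (if k < l then x k ?t else x k ?s)" if "k \<in> {1..n}" for k
    using Suc.IH[OF _ that] Suc.prems by (auto simp: l_def)
  have succ: "run n ok ?S c (i * n + Suc r) =
    (if A l \<inter> grid_cell h i \<noteq> {} then jump (ok i) l (run n ok ?S c (i * n + r)) else run n ok ?S c (i * n + r))"
    using pS p by (simp add: l_def)
  show ?case
  proof (cases "A l \<inter> grid_cell h i = {}")
    case True
    then show ?thesis using succ IH[OF Suc.prems(2)] unchanged[OF l(1)] by (auto simp: l_def)
  next
    case False
    then obtain t where t: "t \<in> A l" "t \<in> grid_cell h i" by auto
    have others: "x k ?t = x k ?s" if "k \<in> {1..n}" "k \<noteq> l" for k
      using that sep[OF i that(1) l(3), of _ t] t by (intro unchanged) auto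
    have only: "A l \<inter> grid_cell h i = {t}"
      using sep[OF i l(3) l(3)] t by blast
    have "x l ?t = x l t"
    proof (rule evolution_const[OF ev l(1)])
      show "0 \<le> t" "t \<le> ?t" using t(2) st unfolding grid_cell_def by auto
      have "t' = t" if "t' \<in> A l" "t' \<in> {?s<..?t}" for t'
        using only that unfolding grid_cell_def by blast
      moreover have "{t<..?t} \<subseteq> {?s<..?t}" using t(2) unfolding grid_cell_def by auto
      ultimately show "A l \<inter> {t<..?t} = {}" by fastforce
    qed
    moreover obtain u where u: "?s < u" "u < t" "evolution_step allowed x l u t"
      using evolution_attempt[OF ev l(1) t(1), of ?s] t by (auto simp: grid_cell_def)
    \<comment> \<open>The rule for the jump is available at some \<open>u\<close> inside the cell
      before \<open>t\<close>. As \<open>t\<close> is the only attempt in the cell, all labels up to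
      \<open>n\<close> still have at \<open>u\<close> their positions from the start of the
      cell.\<close>
    moreover have same: "x k u = x k ?s" if "k \<in> {1..n}" for k
    proof (rule evolution_const[OF ev])
      show "A k \<inter> {?s<..u} = {}"
      proof (rule ccontr)
        assume "A k \<inter> {?s<..u} \<noteq> {}"
        then obtain t' where t': "t' \<in> A k" "?s < t'" "t' \<le> u" by auto
        then have "t' \<in> grid_cell h i" using u t by (auto simp: grid_cell_def)
        with sep[OF i that l(3)] t t' have "t' = t" by blast
        with t' u show False by simp
      qed
    qed (use that u st in auto)
    \<comment> \<open>Exclusion refers to all labels, including those above \<open>n\<close>. By the
      ordering, labels behind \<open>l\<close> are too low and labels ahead of l - 1 too high to
      occupy the target site.\<close>
    moreover have free: "(\<forall>j\<ge>1. x j u \<noteq> x l u + 1) \<longleftrightarrow> l = 1 \<or> x (l - 1) u \<noteq> x l u + 1"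
    proof
      assume *: "l = 1 \<or> x (l - 1) u \<noteq> x l u + 1"
      have u0: "0 \<le> u" using u st by linarith
      show "\<forall>j\<ge>1. x j u \<noteq> x l u + 1"
      proof (intro allI impI)
        fix j :: nat assume j: "1 \<le> j"
        consider "j = l" | "l < j" | "j = l - 1" "l \<noteq> 1" | "j < l - 1" using j by linarith
        then show "x j u \<noteq> x l u + 1"
        proof cases
          case 2 then show ?thesis using decr[OF l(1) _ u0, of j] by simp
        next
          case 4
          then have "x (l - 1) u < x j u" "x l u < x (l - 1) u"
            using decr[OF j _ u0, of "l - 1"] decr[OF _ _ u0, of "l - 1" l] j by auto
          then show ?thesis by simp
        qed (use * in auto)
      qed
    qed (use l in auto)
    moreover have "x l u = x l ?s" using same l by simp
    moreover have "l = 1 \<or> x (l - 1) u = x (l - 1) ?s" using same[of "l - 1"] l by (cases "l = 1") force+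
    ultimately have "x l ?t = (if ok i (x l ?s + 1) \<and> (l = 1 \<or> x (l - 1) ?s \<noteq> x l ?s + 1)
        then x l ?s + 1 else x l ?s)"
      using ok[OF _ l(3), of t] t unfolding evolution_step_def free by auto
    \<comment> \<open>\<open>run\<close> has already served l - 1 in this cell, but that label did
      not attempt here, so the exclusion test sees the correct position.\<close>
    moreover have left: "l = 1 \<or> run n ok ?S c (i * n + r) (l - 1) = x (l - 1) ?s"
    proof (cases "l = 1")
      case False
      then have "l - 1 \<in> {1..n}" using l by auto
      then show ?thesis using IH[of "l - 1"] others[of "l - 1"] False by auto
    qed simp
    ultimately have "jump (ok i) l (run n ok ?S c (i * n + r)) l = x l ?t"
      using IH[OF l(3)] left by (auto simp: jump_def)
    moreover have "jump (ok i) l (run n ok ?S c (i * n + r)) k = run n ok ?S c (i * n + r) k"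
      if "k \<noteq> l" for k using that by (simp add: jump_def)
    ultimately show ?thesis using False succ IH[OF Suc.prems(2)] Suc.prems
      by (cases "m = l") (auto simp: l_def)
  qed
qed

text \<open>The second claim holds at every step, not only at cell boundaries, because label
  \<open>n\<close> is served last and keeps its position from the start of the cell until then. The
  wall inequalities of \<open>run_duality\<close> need exactly this.\<close>

lemma run_eq_evolution:
  assumes ev: "tasep_evolution allowed A x" and h: "0 \<le> h" and n: "0 < n"
    and order: "\<forall>m\<ge>1. \<forall>t\<ge>0. x (m + 1) t < x m t"
    and sepa: "attempts_separated n N h A"
    and oka: "\<forall>i<N. \<forall>m\<in>{1..n}. \<forall>t\<in>A m \<inter> grid_cell h i. allowed t = ok i"
    and c: "\<forall>m\<in>{1..n}. c m = x m 0"
  shows "i \<le> N \<Longrightarrow> m \<in> {1..n} \<Longrightarrow>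
      run n ok (attempted_cells n N h A) c (i * n) m = x m (real i * h)" (is "_ \<Longrightarrow> _ \<Longrightarrow> ?P i m")
    and "p < N * n \<Longrightarrow>
      run n ok (attempted_cells n N h A) c p n = x n (real (p div n) * h)"
proof -
  have *: "?P i m" if "i \<le> N" "m \<in> {1..n}" for i m
    using that
  proof (induction i arbitrary: m)
    case 0
    then show ?case using c by simp
  next
    case (Suc i)
    have "run n ok (attempted_cells n N h A) c (i * n + n) m = x m (real (Suc i) * h)"
      using run_eq_evolution_in_cell[where i = i and N = N and r = n, OF ev h order sepa oka] Suc by simp
    then show ?case by (simp add: add.commute)
  qed
  then show "i \<le> N \<Longrightarrow> m \<in> {1..n} \<Longrightarrow> ?P i m" .
  assume p: "p < N * n"
  then have i: "p div n < N" by (simp add: less_mult_imp_div_less)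
  have "run n ok (attempted_cells n N h A) c (p div n * n + p mod n) n = x n (real (p div n) * h)"
    using run_eq_evolution_in_cell[where i = "p div n" and N = N and r = "p mod n", OF ev h order sepa oka i, of c n] * i n
      mod_less_divisor[OF n, of p] by simp
  then show "run n ok (attempted_cells n N h A) c p n = x n (real (p div n) * h)" by simp
qed

section \<open>Avoiding grid cells\<close>

text \<open>The length of the part of the cells \<open>J\<close> that lies to the right of \<open>a\<close>.\<close>

definition grid_length :: "real \<Rightarrow> nat set \<Rightarrow> real \<Rightarrow> real" where
  "grid_length h J a = (\<Sum>i\<in>J. max a (real (Suc i) * h) - max a (real i * h))"

lemma grid_length_nonneg: "0 \<le> h \<Longrightarrow> 0 \<le> grid_length h J a"
  unfolding grid_length_def by (intro sum_nonneg) (auto simp: max_def algebra_simps)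

lemma grid_length_0: "0 \<le> h \<Longrightarrow> grid_length h J 0 = h * real (card J)"
  by (simp add: grid_length_def max_def algebra_simps zero_le_mult_iff sum.distrib)

lemma grid_length_eq_0:
  assumes "0 \<le> h" "\<And>i. i \<in> J \<Longrightarrow> real (Suc i) * h \<le> a"
  shows "grid_length h J a = 0"
proof -
  have "max a (real (Suc i) * h) - max a (real i * h) = 0" if "i \<in> J" for i
    using assms(2)[OF that] assms(1) by (auto simp: max_def algebra_simps)
  then show ?thesis by (simp add: grid_length_def)
qed

lemma borel_measurable_grid_length [measurable]: "grid_length h J \<in> borel_measurable borel"
  unfolding grid_length_def[abs_def] by measurable

lemma grid_cell_disjoint:
  assumes "0 \<le> h" "t \<in> grid_cell h i" "t \<in> grid_cell h j"
  shows "i = j"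
proof -
  have "\<not> i < j" if "0 \<le> h" "t \<in> grid_cell h i" "t \<in> grid_cell h j" for i j
  proof
    assume "i < j"
    then have "real (Suc i) * h \<le> real j * h" using that(1) by (intro mult_right_mono) auto
    then show False using that by (auto simp: grid_cell_def)
  qed
  from this[OF assms] this[OF assms(1,3,2)] show ?thesis by simp
qed

lemma has_real_derivative_max_const:
  fixes c x :: real
  assumes "x \<noteq> c"
  shows "((\<lambda>x. max x c) has_real_derivative (if c < x then 1 else 0)) (at x)"
proof (cases "c < x")
  case True
  have "((\<lambda>x. x) has_real_derivative 1) (at x)" by (rule DERIV_ident)
  then have "((\<lambda>x. max x c) has_real_derivative 1) (at x)"
    by (rule has_field_derivative_transform_within_open[where S = "{c<..}"]) (use True in auto)
  then show ?thesis using True by simp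
next
  case False
  have "((\<lambda>x. c) has_real_derivative 0) (at x)" by (rule DERIV_const)
  then have "((\<lambda>x. max x c) has_real_derivative 0) (at x)"
    by (rule has_field_derivative_transform_within_open[where S = "{..<c}"]) (use False assms in auto)
  then show ?thesis using False by simp
qed

lemma grid_length_derivative:
  assumes h: "0 \<le> h" and J: "finite J" and x: "x \<notin> (\<lambda>i. real i * h) ` (J \<union> Suc ` J)"
  shows "(grid_length h J has_real_derivative - indicator (\<Union>i\<in>J. grid_cell h i) x) (at x)"
proof -
  have "((\<lambda>a. \<Sum>i\<in>J. max a (real (Suc i) * h) - max a (real i * h)) has_real_derivative
      (\<Sum>i\<in>J. (if real (Suc i) * h < x then 1 else 0) - (if real i * h < x then 1 else 0))) (at x)"
  proof (intro DERIV_sum DERIV_diff has_real_derivative_max_const)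
    fix i assume "i \<in> J"
    then show "x \<noteq> real (Suc i) * h" "x \<noteq> real i * h" using x by blast+
  qed
  moreover have "(if real (Suc i) * h < x then 1 else 0) - (if real i * h < x then 1 else 0) =
      - (indicator (grid_cell h i) x :: real)" if "i \<in> J" for i
    using h by (auto simp: grid_cell_def indicator_def algebra_simps)
  moreover have "(\<Sum>i\<in>J. indicator (grid_cell h i) x) = (indicator (\<Union>i\<in>J. grid_cell h i) x :: real)"
    using grid_cell_disjoint[OF h] by (intro indicator_UN_disjoint[symmetric] J) (auto simp: disjoint_family_on_def)
  ultimately show ?thesis
    unfolding grid_length_def[abs_def] by (simp add: sum_negf)
qed

lemma continuous_grid_length: "continuous_on A (grid_length h J)"
  unfolding grid_length_def[abs_def] by (intro continuous_intros)

text \<open>For y > 0 the integrand is the derivative of - exp (- y) * exp (- L (a + y)) with L =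
  \<open>grid_length h J\<close>: differentiating L contributes the indicator of the cells, which
  turns the factor 1 into the indicator of their complement. Probabilistically, exp (- L a) is the
  chance that a rate one Poisson process avoids the cells after a, decomposed by its first
  point.\<close>

lemma exponential_avoids_grid_cells:
  fixes a h :: real
  assumes h: "0 \<le> h" and J: "finite J"
  defines "U \<equiv> \<Union>i\<in>J. grid_cell h i"
  shows "(\<integral>\<^sup>+y. ennreal (exponential_density 1 y) *
      (indicator (- U) (a + y) * ennreal (exp (- grid_length h J (a + y)))) \<partial>lborel) =
    ennreal (exp (- grid_length h J a))"
proof -
  let ?L = "grid_length h J"
  let ?g = "\<lambda>y. exp (- y) * (indicator (- U) (a + y) * exp (- ?L (a + y))) :: real"
  let ?E = "(\<lambda>i. real i * h) ` (J \<union> Suc ` J)"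
  \<comment> \<open>Beyond a + B there are no cells left and the integrand is plainly exp (- y). The
    inserted 0 gives B \<ge> 0 and covers empty \<open>J\<close>.\<close>
  define B where "B = Max (insert 0 ((\<lambda>e. e - a) ` ?E))"
  have B: "0 \<le> B" "\<And>e. e \<in> ?E \<Longrightarrow> e \<le> a + B"
  proof -
    have fin: "finite (insert 0 ((\<lambda>e. e - a) ` ?E))" using J by auto
    show "0 \<le> B" unfolding B_def using fin by (intro Max_ge) auto
    fix e assume "e \<in> ?E"
    then have "e - a \<le> B" unfolding B_def using fin by (intro Max_ge) auto
    then show "e \<le> a + B" by simp
  qed
  have beyond: "?L (a + y) = 0" "a + y \<notin> U" if "B < y" for y
  proof -
    have e: "real (Suc i) * h < a + y" if "i \<in> J" for i
    proof -
      have "real (Suc i) * h \<in> ?E" using that by blast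
      from B(2)[OF this] \<open>B < y\<close> show ?thesis by auto
    qed
    show "?L (a + y) = 0" using e by (intro grid_length_eq_0 h less_imp_le)
    show "a + y \<notin> U" using e by (force simp: U_def grid_cell_def)
  qed
  have LB: "?L (a + B) = 0" using B(2) by (intro grid_length_eq_0 h) blast
  have 1: "(?g has_integral (- exp (- B) * exp (- ?L (a + B))) - (- exp (- 0) * exp (- ?L (a + 0)))) {0..B}"
  proof (rule fundamental_theorem_of_calculus_interior_strong[where S = "(\<lambda>e. e - a) ` ?E"])
    fix y assume y: "y \<in> {0<..<B} - (\<lambda>e. e - a) ` ?E"
    have "a + y \<notin> ?E"
    proof
      assume "a + y \<in> ?E"
      then have "a + y - a \<in> (\<lambda>e. e - a) ` ?E" by (rule imageI)
      with y show False by simp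
    qed
    then have D: "((\<lambda>y. ?L (a + y)) has_real_derivative - indicator U (a + y)) (at y)"
      using DERIV_chain2[OF grid_length_derivative[OF h J], of "\<lambda>y. a + y" y 1]
        DERIV_add[OF DERIV_const[of a] DERIV_ident, of y UNIV] by (simp add: U_def)
    have "((\<lambda>y. - exp (- y) * exp (- ?L (a + y))) has_real_derivative ?g y) (at y)"
      proof (rule DERIV_cong[OF DERIV_mult])
      show "((\<lambda>y. - exp (- y)) has_real_derivative exp (- y)) (at y)"
        by (auto intro!: derivative_eq_intros)
      show "((\<lambda>y. exp (- ?L (a + y))) has_real_derivative
          exp (- ?L (a + y)) * - (- indicator U (a + y))) (at y)"
        by (intro DERIV_fun_exp DERIV_minus D)
    qed (auto simp: indicator_def)
    then show "((\<lambda>y. - exp (- y) * exp (- ?L (a + y))) has_vector_derivative ?g y) (at y)"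
      by (simp add: has_real_derivative_iff_has_vector_derivative)
  next
    show "continuous_on {0..B} (\<lambda>y. - exp (- y) * exp (- ?L (a + y)))"
      by (intro continuous_intros continuous_on_compose2[OF continuous_grid_length]) auto
  qed (use B J in auto)
  have "((\<lambda>y. exp (- 1 * y)) has_integral exp (- 1 * B) / 1) {B..}"
    by (rule has_integral_exp_minus_to_infinity) simp
  then have 2: "(?g has_integral exp (- B)) {B..}"
    by (intro has_integral_spike[of "{B}" _ ?g "\<lambda>y. exp (- 1 * y)", THEN has_integral_eq_rhs])
      (auto simp: beyond)
  have "(?g has_integral (- exp (- B) * exp (- ?L (a + B))) - (- exp (- 0) * exp (- ?L (a + 0))) + exp (- B))
      ({0..B} \<union> {B..})"
    by (rule has_integral_Un[OF 1 2]) (rule negligible_subset[of "{B}"], auto)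
  moreover have "{0..B} \<union> {B..} = {0..}" using B(1) by auto
  ultimately have "(?g has_integral exp (- ?L a)) {0..}" by (simp add: LB)
  then have "((\<lambda>y. if y \<in> {0..} then ?g y else 0) has_integral exp (- ?L a)) UNIV"
    by (simp only: has_integral_restrict_UNIV)
  moreover have "U \<in> sets borel" unfolding U_def grid_cell_def using J by auto
  then have "(\<lambda>y. if y \<in> {0..} then ?g y else 0) \<in> borel_measurable borel"
    by measurable
  ultimately have "(\<integral>\<^sup>+y. ennreal (if y \<in> {0..} then ?g y else 0) \<partial>lborel) = ennreal (exp (- ?L a))"
    by (intro nn_integral_has_integral_lborel) auto
  moreover have "ennreal (exponential_density 1 y) *
      (indicator (- U) (a + y) * ennreal (exp (- ?L (a + y)))) = ennreal (if y \<in> {0..} then ?g y else 0)" for y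
    by (auto simp: exponential_density_def indicator_def ennreal_mult')
  ultimately show ?thesis by simp
qed

section \<open>Renewal sums of exponential waiting times\<close>

context prob_space
begin

lemma exponential_AE_pos:
  assumes "distributed M lborel X (exponential_density 1)"
  shows "AE \<omega> in M. 0 < X \<omega>"
proof -
  have "prob {\<omega> \<in> space M. X \<omega> \<le> 0} = 0"
    using exponential_distributedD_le[OF assms order_refl] by simp
  moreover have "X \<in> borel_measurable M" using distributed_measurable[OF assms] by simp
  ultimately show ?thesis
    by (subst AE_iff_measurable[OF _ refl]) (auto simp: emeasure_eq_measure not_less)
qed

text \<open>The sum of k + 1 variables is Erlang distributed, and the probability that it stays
  below a is 1 minus exp (- a) times the partial exponential series, which tends to 0. So the sums
  are almost surely unbounded, and positivity makes them increase.\<close>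

lemma exponential_sums_at_top:
  fixes X :: "nat \<Rightarrow> 'a \<Rightarrow> real"
  assumes ind: "indep_vars (\<lambda>_. borel) X UNIV"
    and X: "\<And>k. distributed M lborel (X k) (exponential_density 1)"
  shows "AE \<omega> in M. filterlim (\<lambda>k. \<Sum>i<k. X i \<omega>) at_top sequentially"
proof -
  have [measurable]: "X k \<in> borel_measurable M" for k using distributed_measurable[OF X] by simp
  let ?S = "\<lambda>k \<omega>. \<Sum>i<k. X i \<omega>"
  have null: "AE \<omega> in M. \<not> (\<forall>k. ?S k \<omega> \<le> real a)" for a :: nat
  proof -
    have "prob {\<omega> \<in> space M. \<forall>k. ?S k \<omega> \<le> real a} \<le> erlang_CDF k 1 (real a)" for k
    proof -
      have "distributed M lborel (\<lambda>\<omega>. \<Sum>i\<in>{..<Suc k}. X i \<omega>) (erlang_density (card {..<Suc k} - 1) 1)"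
        by (intro exponential_distributed_sum X indep_vars_subset[OF ind]) auto
      then have "prob {\<omega> \<in> space M. ?S (Suc k) \<omega> \<le> real a} = erlang_CDF k 1 (real a)"
        by (intro erlang_distributed_le) auto
      moreover have "prob {\<omega> \<in> space M. \<forall>k. ?S k \<omega> \<le> real a} \<le> prob {\<omega> \<in> space M. ?S (Suc k) \<omega> \<le> real a}"
        by (intro finite_measure_mono) (auto simp del: sum.lessThan_Suc)
      ultimately show ?thesis by simp
    qed
    moreover have "(\<lambda>k. erlang_CDF k 1 (real a)) \<longlonglongrightarrow> 0"
    proof -
      have "(\<lambda>k. \<Sum>n\<le>k. real a ^ n /\<^sub>R fact n) \<longlonglongrightarrow> exp (real a)"
        using exp_converges[of "real a"] unfolding sums_def_le .
      then have "(\<lambda>k. 1 - (\<Sum>n\<le>k. real a ^ n /\<^sub>R fact n) * exp (- real a)) \<longlonglongrightarrow> 1 - exp (real a) * exp (- real a)"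
        by (intro tendsto_intros)
      moreover have "erlang_CDF k 1 (real a) = 1 - (\<Sum>n\<le>k. real a ^ n /\<^sub>R fact n) * exp (- real a)" for k
        unfolding erlang_CDF_def sum_distrib_right by (simp add: divide_inverse ac_simps)
      ultimately show ?thesis by (simp add: exp_minus_inverse)
    qed
    ultimately have "prob {\<omega> \<in> space M. \<forall>k. ?S k \<omega> \<le> real a} \<le> 0"
      by (intro LIMSEQ_le_const) auto
    then show ?thesis
      by (subst AE_iff_measurable[OF _ refl]) (auto simp: emeasure_eq_measure measure_le_0_iff)
  qed
  have "AE \<omega> in M. \<forall>a::nat. \<not> (\<forall>k. ?S k \<omega> \<le> real a)"
    using null by (simp add: AE_all_countable)
  moreover have "AE \<omega> in M. \<forall>k. 0 < X k \<omega>"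
    using exponential_AE_pos[OF X] by (simp add: AE_all_countable)
  ultimately show ?thesis
  proof eventually_elim
    case (elim \<omega>)
    have "incseq (\<lambda>k. ?S k \<omega>)" using elim(2) by (intro incseq_SucI) (simp add: less_imp_le)
    show ?case unfolding filterlim_at_top_ge[of _ _ 0]
    proof (intro allI impI)
      fix Z :: real assume "0 \<le> Z"
      obtain a :: nat where "Z \<le> real a" using real_arch_simple by blast
      moreover obtain k where "real a < ?S k \<omega>" using elim(1) by (meson not_less)
      ultimately have "Z \<le> ?S k \<omega>" by simp
      then have "\<forall>j\<ge>k. Z \<le> ?S j \<omega>" using \<open>incseq _\<close> by (meson incseqD order_trans)
      then show "eventually (\<lambda>j. Z \<le> ?S j \<omega>) sequentially" by (auto simp: eventually_sequentially)
    qed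
  qed
qed

text \<open>Averaging over X k with the earlier variables fixed replaces the factor at sum k + 1 by
  the factor at sum k, by \<open>exponential_avoids_grid_cells\<close>. The expectation therefore
  keeps its value at k = 0. The product starts at j = 1 because the empty sum is not an
  attempt.\<close>

lemma avoidance_martingale:
  fixes X :: "nat \<Rightarrow> 'a \<Rightarrow> real" and h :: real
  assumes ind: "indep_vars (\<lambda>_. borel) X UNIV"
    and X: "\<And>k. distributed M lborel (X k) (exponential_density 1)"
    and h: "0 \<le> h" and J: "finite J"
  defines "U \<equiv> \<Union>i\<in>J. grid_cell h i"
  shows "(\<integral>\<^sup>+\<omega>. (\<Prod>j\<in>{1..k}. indicator (- U) (\<Sum>i<j. X i \<omega>)) *
      ennreal (exp (- grid_length h J (\<Sum>i<k. X i \<omega>))) \<partial>M) = ennreal (exp (- (h * card J)))"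
proof (induction k)
  case 0
  show ?case by (simp add: grid_length_0[OF h] emeasure_space_1)
next
  case (Suc k)
  let ?L = "\<lambda>a. ennreal (exp (- grid_length h J a))"
  have [measurable]: "X k \<in> borel_measurable M" for k using distributed_measurable[OF X] by simp
  have [measurable]: "U \<in> sets borel" unfolding U_def grid_cell_def using J by auto
  let ?B = "PiM {..<k} (\<lambda>_. borel) :: (nat \<Rightarrow> real) measure"
  \<comment> \<open>\<open>indep_var_restrict\<close> speaks about subfamilies, so the single
    variable X k is carried as a family over {k} and evaluated at k later.\<close>
  let ?C = "PiM {k} (\<lambda>_. borel) :: (nat \<Rightarrow> real) measure"
  let ?R = "\<lambda>\<omega>. \<lambda>i\<in>{..<k}. X i \<omega>" and ?Q = "\<lambda>\<omega>. \<lambda>i\<in>{k}. X i \<omega>"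
  define P where "P x = (\<Prod>j\<in>{1..k}. indicator (- U) (\<Sum>i<j. x i) :: ennreal)" for x :: "nat \<Rightarrow> real"
  define F where "F x y = P x * (indicator (- U) ((\<Sum>i<k. x i) + y) * ?L ((\<Sum>i<k. x i) + y))"
    for x :: "nat \<Rightarrow> real" and y :: real
  have sm: "(\<lambda>x. \<Sum>i<j. x i) \<in> borel_measurable ?B" if "j \<le> k" for j
    using that by (intro borel_measurable_sum measurable_component_singleton) auto
  have [measurable]: "P \<in> borel_measurable ?B"
    unfolding P_def[abs_def]
  proof (intro borel_measurable_prod_ennreal)
    fix j assume "j \<in> {1..k}"
    then have [measurable]: "(\<lambda>x. \<Sum>i<j. x i) \<in> borel_measurable ?B" by (intro sm) auto
    show "(\<lambda>x. indicator (- U) (\<Sum>i<j. x i) :: ennreal) \<in> borel_measurable ?B" by measurable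
  qed
  have [measurable]: "(\<lambda>x. \<Sum>i<k. x i) \<in> borel_measurable ?B" by (rule sm) simp
  have F[measurable]: "case_prod F \<in> borel_measurable (?B \<Otimes>\<^sub>M borel)"
    unfolding F_def by measurable
  have [measurable]: "?R \<in> measurable M ?B" "?Q \<in> measurable M ?C" by measurable
  have ev: "(\<lambda>y. y k) \<in> borel_measurable ?C" by (rule measurable_component_singleton) simp
  have G[measurable]: "(\<lambda>z. F (fst z) (snd z k)) \<in> borel_measurable (?B \<Otimes>\<^sub>M ?C)"
    using measurable_compose[OF measurable_Pair[OF measurable_fst measurable_compose[OF measurable_snd ev]] F]
    by simp
  have "indep_var ?B ?R ?C ?Q"
    by (rule indep_var_restrict[OF ind]) auto
  then have joint: "distr M (?B \<Otimes>\<^sub>M ?C) (\<lambda>\<omega>. (?R \<omega>, ?Q \<omega>)) = distr M ?B ?R \<Otimes>\<^sub>M distr M ?C ?Q"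
    by (simp add: indep_var_distribution_eq)
  have dk: "distr M borel (X k) = density lborel (exponential_density 1)"
    using distributed_distr_eq_density[OF X[of k]] by (simp cong: distr_cong)
  interpret Q: prob_space "distr M ?C ?Q" by (rule prob_space_distr) simp
  have "(\<integral>\<^sup>+\<omega>. (\<Prod>j\<in>{1..Suc k}. indicator (- U) (\<Sum>i<j. X i \<omega>)) * ?L (\<Sum>i<Suc k. X i \<omega>) \<partial>M) =
      (\<integral>\<^sup>+\<omega>. F (?R \<omega>) (X k \<omega>) \<partial>M)"
  proof (intro nn_integral_cong)
    fix \<omega>
    have s: "(\<Sum>i<j. ?R \<omega> i) = (\<Sum>i<j. X i \<omega>)" if "j \<le> k" for j
      using that by (intro sum.cong) auto
    have "P (?R \<omega>) = (\<Prod>j\<in>{1..k}. indicator (- U) (\<Sum>i<j. X i \<omega>))"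
      unfolding P_def by (intro prod.cong refl) (simp only: s atLeastAtMost_iff)
    then show "(\<Prod>j\<in>{1..Suc k}. indicator (- U) (\<Sum>i<j. X i \<omega>)) * ?L (\<Sum>i<Suc k. X i \<omega>) =
        F (?R \<omega>) (X k \<omega>)"
      unfolding F_def s[OF order_refl] by (simp add: prod.nat_ivl_Suc' ac_simps)
  qed
  also have "\<dots> = (\<integral>\<^sup>+z. F (fst z) (snd z k) \<partial>distr M (?B \<Otimes>\<^sub>M ?C) (\<lambda>\<omega>. (?R \<omega>, ?Q \<omega>)))"
    by (subst nn_integral_distr) (auto intro!: nn_integral_cong G)
  also have "\<dots> = (\<integral>\<^sup>+z. F (fst z) (snd z k) \<partial>(distr M ?B ?R \<Otimes>\<^sub>M distr M ?C ?Q))"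
    unfolding joint ..
  also have "\<dots> = (\<integral>\<^sup>+x. \<integral>\<^sup>+y. F x (y k) \<partial>distr M ?C ?Q \<partial>distr M ?B ?R)"
    by (subst Q.nn_integral_fst[symmetric])
      (use G in \<open>simp_all cong: measurable_cong_sets sets_pair_measure_cong\<close>)
  also have "\<dots> = (\<integral>\<^sup>+x. P x * ?L (\<Sum>i<k. x i) \<partial>distr M ?B ?R)"
  proof (intro nn_integral_cong)
    fix x :: "nat \<Rightarrow> real" assume x: "x \<in> space (distr M ?B ?R)"
    let ?s = "\<Sum>i<k. x i"
    have [measurable]: "F x \<in> borel_measurable borel" unfolding F_def[abs_def] by measurable
    have "(\<integral>\<^sup>+y. F x (y k) \<partial>distr M ?C ?Q) = (\<integral>\<^sup>+\<omega>. F x (X k \<omega>) \<partial>M)"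
      using measurable_compose[OF ev \<open>F x \<in> _\<close>] by (subst nn_integral_distr) auto
    also have "\<dots> = (\<integral>\<^sup>+y. F x y \<partial>distr M borel (X k))"
      by (subst nn_integral_distr) auto
    also have "\<dots> = P x * (\<integral>\<^sup>+y. (indicator (- U) (?s + y) * ?L (?s + y)) \<partial>distr M borel (X k))"
      unfolding F_def by (rule nn_integral_cmult) measurable
    also have "(\<integral>\<^sup>+y. (indicator (- U) (?s + y) * ?L (?s + y)) \<partial>distr M borel (X k)) = ?L ?s"
      unfolding dk using exponential_avoids_grid_cells[OF h J, of ?s, folded U_def]
      by (subst nn_integral_density) simp_all
    finally show "(\<integral>\<^sup>+y. F x (y k) \<partial>distr M ?C ?Q) = P x * ?L ?s" .
  qed
  also have "\<dots> = (\<integral>\<^sup>+\<omega>. P (?R \<omega>) * ?L (\<Sum>i<k. ?R \<omega> i) \<partial>M)"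
    by (subst nn_integral_distr) auto
  also have "\<dots> = (\<integral>\<^sup>+\<omega>. (\<Prod>j\<in>{1..k}. indicator (- U) (\<Sum>i<j. X i \<omega>)) * ?L (\<Sum>i<k. X i \<omega>) \<partial>M)"
  proof (intro nn_integral_cong)
    fix \<omega>
    have s: "(\<Sum>i<j. ?R \<omega> i) = (\<Sum>i<j. X i \<omega>)" if "j \<le> k" for j
      using that by (intro sum.cong) auto
    have "P (?R \<omega>) = (\<Prod>j\<in>{1..k}. indicator (- U) (\<Sum>i<j. X i \<omega>))"
      unfolding P_def by (intro prod.cong refl) (simp only: s atLeastAtMost_iff)
    then show "P (?R \<omega>) * ?L (\<Sum>i<k. ?R \<omega> i) = (\<Prod>j\<in>{1..k}. indicator (- U) (\<Sum>i<j. X i \<omega>)) * ?L (\<Sum>i<k. X i \<omega>)"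
      by (simp only: s[OF order_refl])
  qed
  also note Suc.IH
  finally show ?case .
qed

lemma void_probability:
  fixes X :: "nat \<Rightarrow> 'a \<Rightarrow> real" and h :: real
  assumes ind: "indep_vars (\<lambda>_. borel) X UNIV"
    and X: "\<And>k. distributed M lborel (X k) (exponential_density 1)"
    and h: "0 \<le> h" and J: "finite J"
  shows "prob {\<omega> \<in> space M. \<forall>i\<in>J. attempt_times (\<lambda>k. X k \<omega>) \<inter> grid_cell h i = {}} = exp (- (h * card J))"
proof -
  \<comment> \<open>The sums leave every bounded set, so the martingale converges to the indicator of avoidance.\<close>
  define U where "U = (\<Union>i\<in>J. grid_cell h i)"
  let ?S = "\<lambda>k \<omega>. \<Sum>i<k. X i \<omega>"
  let ?u = "\<lambda>k \<omega>. (\<Prod>j\<in>{1..k}. indicator (- U) (?S j \<omega>)) * ennreal (exp (- grid_length h J (?S k \<omega>)))"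
  have [measurable]: "X k \<in> borel_measurable M" for k using distributed_measurable[OF X] by simp
  have [measurable]: "U \<in> sets borel" unfolding U_def grid_cell_def using J by auto
  define V where "V = {\<omega> \<in> space M. \<forall>j. ?S (Suc j) \<omega> \<notin> U}"
  have [measurable]: "V \<in> events" unfolding V_def by measurable
  have V: "V = {\<omega> \<in> space M. \<forall>i\<in>J. attempt_times (\<lambda>k. X k \<omega>) \<inter> grid_cell h i = {}}"
    by (auto simp: V_def U_def attempt_times_def lessThan_Suc_atMost)
  have "(\<lambda>k. \<integral>\<^sup>+\<omega>. ?u k \<omega> \<partial>M) \<longlonglongrightarrow> (\<integral>\<^sup>+\<omega>. indicator V \<omega> \<partial>M)"
  proof (rule nn_integral_dominated_convergence)
    have "(\<Prod>j\<in>{1..k}. indicator (- U) (?S j \<omega>)) \<le> (1::ennreal)" for k \<omega>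
      by (intro prod_le_1) (auto simp: indicator_def)
    moreover have "ennreal (exp (- grid_length h J a)) \<le> 1" for a
      using grid_length_nonneg[OF h, of J a] by simp
    ultimately show "AE \<omega> in M. ?u k \<omega> \<le> 1" for k
      by (intro AE_I2) (metis mult_mono mult_1 zero_le)
    show "AE \<omega> in M. (\<lambda>k. ?u k \<omega>) \<longlonglongrightarrow> indicator V \<omega>"
      using exponential_sums_at_top[OF ind X] AE_space
    proof eventually_elim
      case (elim \<omega>)
      \<comment> \<open>A sum of nonnegative right ends bounds each of them, and unlike a maximum it
        needs no separate case for empty \<open>J\<close>.\<close>
      define b where "b = (\<Sum>i\<in>J. real (Suc i) * h)"
      have b: "real (Suc i) * h \<le> b" if "i \<in> J" for i
        unfolding b_def using h by (intro member_le_sum J that) auto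
      have 1: "eventually (\<lambda>k. b \<le> ?S k \<omega>) sequentially"
        using elim(1) by (auto simp: filterlim_at_top)
      have "eventually (\<lambda>k. ?u k \<omega> = indicator V \<omega>) sequentially"
      proof (cases "\<omega> \<in> V")
        case True
        have "?u k \<omega> = 1" if "b \<le> ?S k \<omega>" for k
        proof -
          have "grid_length h J (?S k \<omega>) = 0"
            using b that by (intro grid_length_eq_0 h) (meson order_trans)
          moreover have "?S j \<omega> \<notin> U" if "j \<in> {1..k}" for j
            using True that by (cases j) (auto simp: V_def)
          then have "(\<Prod>j\<in>{1..k}. indicator (- U) (?S j \<omega>)) = (1::ennreal)"
            by (intro prod.neutral) auto
          ultimately show ?thesis by simp
        qed
        with 1 True show ?thesis by (auto elim: eventually_mono)
      next
        case False
        then obtain j where "?S (Suc j) \<omega> \<in> U" using elim(2) by (auto simp: V_def)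
        then have "?u k \<omega> = 0" if "Suc j \<le> k" for k
          using that by (auto intro!: prod_zero bexI[of _ "Suc j"])
        then show ?thesis using False by (auto simp: eventually_sequentially)
      qed
      then show ?case by (rule tendsto_eventually)
    qed
  qed (auto simp: emeasure_space_1)
  moreover have "(\<integral>\<^sup>+\<omega>. ?u k \<omega> \<partial>M) = ennreal (exp (- (h * card J)))" for k
    using avoidance_martingale[OF ind X h J, of k] by (simp add: U_def)
  ultimately have "emeasure M V = ennreal (exp (- (h * card J)))"
    by (simp add: LIMSEQ_const_iff)
  then show ?thesis by (simp add: emeasure_eq_measure V)
qed

end

section \<open>Law of the attempted cells\<close>

context prob_space
begin

lemma waiting_times_row:
  assumes "waiting_times M W" "1 \<le> m"
  shows "indep_vars (\<lambda>_. borel) (\<lambda>k. W m k) UNIV"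
proof -
  have "indep_vars (\<lambda>_. borel) (\<lambda>(n, k). W n k) ({1..} \<times> UNIV)"
    using assms(1) by (simp add: waiting_times_def)
  then have "indep_vars (\<lambda>k. PiM {(m, k)} (\<lambda>_. borel))
      (\<lambda>k \<omega>. \<lambda>p\<in>{(m, k)}. (case p of (n, k) \<Rightarrow> W n k) \<omega>) UNIV"
    by (rule indep_vars_restrict) (use assms(2) in \<open>auto simp: disjoint_family_on_def\<close>)
  then have "indep_vars (\<lambda>_. borel) (\<lambda>k \<omega>. (\<lambda>p\<in>{(m, k)}. (case p of (n, k) \<Rightarrow> W n k) \<omega>) (m, k)) UNIV"
    by (rule indep_vars_compose2) (auto intro: measurable_component_singleton)
  then show ?thesis by simp
qed

lemma waiting_times_distributed:
  assumes "waiting_times M W" "1 \<le> m"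
  shows "distributed M lborel (W m k) (exponential_density 1)"
  using assms by (simp add: waiting_times_def)

text \<open>Different labels use disjoint blocks of waiting times, so their avoidance events are
  independent and the exponents add. Letting \<open>J\<close> depend on the label covers single
  cells, pairs of labels and arbitrary sets of indices at once.\<close>

lemma joint_void_probability:
  fixes W :: "nat \<Rightarrow> nat \<Rightarrow> 'a \<Rightarrow> real" and J :: "nat \<Rightarrow> nat set"
  assumes W: "waiting_times M W" and n: "0 < n" and h: "0 \<le> h" and J: "\<And>m. finite (J m)"
  shows "prob {\<omega> \<in> space M. \<forall>m\<in>{1..n}. \<forall>i\<in>J m.
      attempt_times (\<lambda>k. W m k \<omega>) \<inter> grid_cell h i = {}} = exp (- (h * (\<Sum>m=1..n. card (J m))))"
proof -
  let ?V = "\<lambda>m. {\<omega> \<in> space M. \<forall>i\<in>J m. attempt_times (\<lambda>k. W m k \<omega>) \<inter> grid_cell h i = {}}"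
  let ?M = "\<lambda>m. PiM ({m} \<times> UNIV) (\<lambda>_. borel) :: (nat \<times> nat \<Rightarrow> real) measure"
  let ?R = "\<lambda>m \<omega>. \<lambda>p\<in>{m} \<times> UNIV. (case p of (n, k) \<Rightarrow> W n k) \<omega>"
  define U where "U m = (\<Union>i\<in>J m. grid_cell h i)" for m
  define B where "B m = {y \<in> space (?M m). \<forall>k. (\<Sum>i\<le>k. y (m, i)) \<notin> U m}" for m
  have [measurable]: "U m \<in> sets borel" for m unfolding U_def grid_cell_def using J by auto
  have B: "B m \<in> sets (?M m)" for m
  proof -
    have [measurable]: "(\<lambda>y. y (m, i)) \<in> borel_measurable (?M m)" for i
      by (rule measurable_component_singleton) simp
    show ?thesis unfolding B_def by measurable
  qed
  have RB: "?R m -` B m \<inter> space M = ?V m" for m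
    by (auto simp: B_def U_def attempt_times_def space_PiM)
  have "indep_vars (\<lambda>_. borel) (\<lambda>(n, k). W n k) ({1..} \<times> UNIV)"
    using W by (simp add: waiting_times_def)
  then have "indep_vars ?M ?R {1..n}"
    by (rule indep_vars_restrict) (auto simp: disjoint_family_on_def)
  from indep_varsD_finite[OF this, of B]
  have "prob (\<Inter>m\<in>{1..n}. ?R m -` B m \<inter> space M) = (\<Prod>m\<in>{1..n}. prob (?R m -` B m \<inter> space M))"
    using n B by auto
  also have "(\<Inter>m\<in>{1..n}. ?R m -` B m \<inter> space M) =
      {\<omega> \<in> space M. \<forall>m\<in>{1..n}. \<forall>i\<in>J m. attempt_times (\<lambda>k. W m k \<omega>) \<inter> grid_cell h i = {}}"
    unfolding RB using n by force
  also have "(\<Prod>m\<in>{1..n}. prob (?R m -` B m \<inter> space M)) = (\<Prod>m\<in>{1..n}. exp (- (h * card (J m))))"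
    unfolding RB
    by (intro prod.cong refl void_probability waiting_times_row[OF W] waiting_times_distributed[OF W] h J) auto
  also have "\<dots> = exp (- (h * (\<Sum>m=1..n. card (J m))))"
    by (simp add: exp_sum[symmetric] sum_negf sum_distrib_left)
  finally show ?thesis .
qed

end

text \<open>The measure is arbitrary because the lemma is applied twice: to the probability space,
  and to the product space of waiting times, where the cells become a function of the family that is
  independent of the initial configuration.\<close>

lemma measurable_attempted_cells:
  assumes "\<And>m k. m \<in> {1..n} \<Longrightarrow> V m k \<in> borel_measurable M"
  shows "(\<lambda>\<omega>. attempted_cells n N h (\<lambda>m. attempt_times (\<lambda>k. V m k \<omega>)))
    \<in> measurable M (count_space (Pow {..<N * n}))"
proof -
  let ?X = "\<lambda>\<omega>. attempted_cells n N h (\<lambda>m. attempt_times (\<lambda>k. V m k \<omega>))"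
  have sub: "?X \<omega> \<subseteq> {..<N * n}" for \<omega> by (auto simp: attempted_cells_def)
  have mem: "{\<omega> \<in> space M. p \<in> ?X \<omega>} \<in> sets M" if "p < N * n" for p
  proof -
    have "0 < n" using that by (cases n) auto
    then have "p mod n + 1 \<in> {1..n}" by (simp add: Suc_leI)
    note [measurable] = assms[OF this]
    have [measurable]: "grid_cell h (p div n) \<in> sets borel" by (simp add: grid_cell_def)
    have "{\<omega> \<in> space M. p \<in> ?X \<omega>} =
        {\<omega> \<in> space M. \<exists>k. (\<Sum>i\<le>k. V (p mod n + 1) i \<omega>) \<in> grid_cell h (p div n)}"
      using that by (auto simp: attempted_cells_def attempt_times_def)
    also have "\<dots> \<in> sets M" by measurable
    finally show ?thesis .
  qed
  have "?X -` {S} \<inter> space M \<in> sets M" if "S \<subseteq> {..<N * n}" for S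
  proof -
    have "A = B \<longleftrightarrow> (\<forall>p\<in>I. if p \<in> B then p \<in> A else \<not> p \<in> A)"
      if "A \<subseteq> I" "B \<subseteq> I" for A B I :: "nat set"
      unfolding if_bool_eq_conj using that by blast
    from this[OF sub that] have "?X -` {S} \<inter> space M =
      {\<omega> \<in> space M. \<forall>p\<in>{..<N * n}. if p \<in> S then p \<in> ?X \<omega> else \<not> p \<in> ?X \<omega>}"
      by (simp only: vimage_def singleton_iff) blast
    also have "\<dots> \<in> sets M"
    proof (rule sets.sets_Collect_finite_All)
      fix p assume "p \<in> {..<N * n}"
      then have "{\<omega> \<in> space M. p \<in> ?X \<omega>} \<in> sets M" using mem by simp
      then show "{\<omega> \<in> space M. if p \<in> S then p \<in> ?X \<omega> else \<not> p \<in> ?X \<omega>} \<in> sets M"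
        using sets.sets_Collect_neg[of M "\<lambda>\<omega>. p \<in> ?X \<omega>"] by (cases "p \<in> S") auto
    qed simp
    finally show ?thesis .
  qed
  moreover have "?X \<in> space M \<rightarrow> Pow {..<N * n}" using sub by blast
  ultimately show ?thesis by (subst measurable_count_space_eq2) blast+
qed

text \<open>Containment in S splits into the disjoint events of being equal to R for the subsets R
  of S. Induction over proper subsets, a Moebius inversion, recovers the point probabilities from
  the containment probabilities.\<close>

lemma (in prob_space) finite_random_set_law_eq:
  assumes fin: "finite I"
    and X: "X \<in> measurable M (count_space (Pow I))" and Y: "Y \<in> measurable M (count_space (Pow I))"
    and eq: "\<And>S. S \<subseteq> I \<Longrightarrow> prob {\<omega> \<in> space M. X \<omega> \<subseteq> S} = prob {\<omega> \<in> space M. Y \<omega> \<subseteq> S}"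
  shows "prob {\<omega> \<in> space M. X \<omega> \<in> F} = prob {\<omega> \<in> space M. Y \<omega> \<in> F}"
proof -
  have decomp: "prob {\<omega> \<in> space M. Z \<omega> \<in> G} = (\<Sum>S\<in>G. prob {\<omega> \<in> space M. Z \<omega> = S})"
    if "Z \<in> measurable M (count_space (Pow I))" "G \<subseteq> Pow I" for Z :: "'a \<Rightarrow> 'b set" and G
  proof -
    have G: "finite G" using that(2) fin by (simp add: finite_subset)
    have "{\<omega> \<in> space M. Z \<omega> \<in> G} = (\<Union>S\<in>G. {\<omega> \<in> space M. Z \<omega> = S})" by auto
    moreover have "{\<omega> \<in> space M. Z \<omega> = S} \<in> events" if "S \<in> G" for S
      using measurable_sets[OF \<open>Z \<in> _\<close>, of "{S}"] that \<open>G \<subseteq> _\<close>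
      by (auto simp: vimage_def Int_def conj_commute)
    ultimately show ?thesis
      using G by (simp only:) (intro finite_measure_finite_Union, auto simp: disjoint_family_on_def)
  qed
  have pt: "prob {\<omega> \<in> space M. X \<omega> = S} = prob {\<omega> \<in> space M. Y \<omega> = S}" if "S \<subseteq> I" for S
    using finite_subset[OF that fin] that
  proof (induction S rule: finite_psubset_induct)
    case (psubset S)
    have "prob {\<omega> \<in> space M. Z \<omega> \<subseteq> S} = prob {\<omega> \<in> space M. Z \<omega> = S} +
        (\<Sum>R\<in>Pow S - {S}. prob {\<omega> \<in> space M. Z \<omega> = R})"
      if "Z \<in> measurable M (count_space (Pow I))" for Z
      using decomp[OF that, of "Pow S"] psubset.prems psubset.hyps
      by (simp add: Pow_def[symmetric] sum.remove[of "Pow S" S] Pow_mono)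
    from this[OF X] this[OF Y] eq[OF psubset.prems]
    have "prob {\<omega> \<in> space M. X \<omega> = S} + (\<Sum>R\<in>Pow S - {S}. prob {\<omega> \<in> space M. X \<omega> = R}) =
      prob {\<omega> \<in> space M. Y \<omega> = S} + (\<Sum>R\<in>Pow S - {S}. prob {\<omega> \<in> space M. Y \<omega> = R})" by simp
    moreover have "(\<Sum>R\<in>Pow S - {S}. prob {\<omega> \<in> space M. X \<omega> = R}) =
        (\<Sum>R\<in>Pow S - {S}. prob {\<omega> \<in> space M. Y \<omega> = R})"
      using psubset.IH psubset.prems by (intro sum.cong refl) blast
    ultimately show ?case by simp
  qed
  have "prob {\<omega> \<in> space M. Z \<omega> \<in> F} = (\<Sum>S\<in>F \<inter> Pow I. prob {\<omega> \<in> space M. Z \<omega> = S})"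
    if Z: "Z \<in> measurable M (count_space (Pow I))" for Z
  proof -
    have "{\<omega> \<in> space M. Z \<omega> \<in> F} = {\<omega> \<in> space M. Z \<omega> \<in> F \<inter> Pow I}"
      using measurable_space[OF Z] by auto
    then show ?thesis using decomp[OF Z, of "F \<inter> Pow I"] by simp
  qed
  from this[OF X] this[OF Y] show ?thesis using pt by (auto intro!: sum.cong)
qed

context prob_space
begin

text \<open>Containment in S means avoiding the indices outside S, so this is
  \<open>joint_void_probability\<close> after sorting those indices by label. Only their number
  enters, which makes the law invariant under every permutation of the indices.\<close>

lemma attempted_cells_subset_prob:
  assumes W: "waiting_times M W" and n: "0 < n" and h: "0 \<le> h" and S: "S \<subseteq> {..<N * n}"
  shows "prob {\<omega> \<in> space M. attempted_cells n N h (\<lambda>m. attempt_times (\<lambda>k. W m k \<omega>)) \<subseteq> S} =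
    exp (- (h * card ({..<N * n} - S)))"
proof -
  define J where "J m = {i \<in> {..<N}. i * n + (m - 1) \<notin> S}" for m
  let ?f = "\<lambda>(m, i). i * n + (m - 1)"
  have divmod: "(i * n + (m - 1)) mod n + 1 = m" "(i * n + (m - 1)) div n = i" if "1 \<le> m" "m \<le> n" for i m
    using that by (cases m; simp)+
  have "bij_betw ?f (SIGMA m:{1..n}. J m) ({..<N * n} - S)"
  proof (rule bij_betwI[where g = "\<lambda>p. (p mod n + 1, p div n)"])
    show "?f \<in> (SIGMA m:{1..n}. J m) \<rightarrow> {..<N * n} - S"
    proof
      fix q assume "q \<in> (SIGMA m:{1..n}. J m)"
      then obtain m i where q: "q = (m, i)" and *: "1 \<le> m" "m \<le> n" "i < N" "i * n + (m - 1) \<notin> S"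
        by (auto simp: J_def)
      then have "i * n + (m - 1) < Suc i * n" by simp
      also have "\<dots> \<le> N * n" using * by (intro mult_le_mono1) simp
      finally show "?f q \<in> {..<N * n} - S" using * q by simp
    qed
    show "(\<lambda>p. (p mod n + 1, p div n)) \<in> {..<N * n} - S \<rightarrow> (SIGMA m:{1..n}. J m)"
      using n by (auto simp: J_def Suc_leI less_mult_imp_div_less)
  next
    fix q assume "q \<in> (SIGMA m:{1..n}. J m)"
    then show "(?f q mod n + 1, ?f q div n) = q" using divmod by (auto simp del: One_nat_def)
  qed (use n in auto)
  then have "card ({..<N * n} - S) = card (SIGMA m:{1..n}. J m)"
    by (simp add: bij_betw_same_card)
  also have "\<dots> = (\<Sum>m=1..n. card (J m))" by (rule card_SigmaI) (auto simp: J_def)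
  finally have card: "card ({..<N * n} - S) = (\<Sum>m=1..n. card (J m))" .
  have "attempted_cells n N h A \<subseteq> S \<longleftrightarrow> (\<forall>m\<in>{1..n}. \<forall>i\<in>J m. A m \<inter> grid_cell h i = {})" for A
  proof (intro iffI ballI)
    fix m i assume "attempted_cells n N h A \<subseteq> S" and m: "m \<in> {1..n}" and i: "i \<in> J m"
    then have p: "i * n + (m - 1) \<notin> attempted_cells n N h A" by (auto simp: J_def)
    have "i * n + (m - 1) < Suc i * n" using m by auto
    also have "\<dots> \<le> N * n" using i by (intro mult_le_mono1) (auto simp: J_def)
    finally have lt: "i * n + (m - 1) < N * n" .
    have m': "1 \<le> m" "m \<le> n" using m by auto
    from p lt show "A m \<inter> grid_cell h i = {}"
      unfolding attempted_cells_def mem_Collect_eq divmod[OF m', of i] by blast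
  next
    assume *: "\<forall>m\<in>{1..n}. \<forall>i\<in>J m. A m \<inter> grid_cell h i = {}"
    show "attempted_cells n N h A \<subseteq> S"
    proof
      fix p assume p: "p \<in> attempted_cells n N h A"
      show "p \<in> S"
      proof (rule ccontr)
        assume "p \<notin> S"
        moreover have "p < N * n" using p by (simp add: attempted_cells_def)
        ultimately have "p div n \<in> J (p mod n + 1)"
          by (simp add: J_def less_mult_imp_div_less)
        moreover have "p mod n + 1 \<in> {1..n}" using n by (simp add: Suc_leI)
        ultimately have "A (p mod n + 1) \<inter> grid_cell h (p div n) = {}" using * by blast
        with p show False unfolding attempted_cells_def by blast
      qed
    qed
  qed
  then show ?thesis
    using joint_void_probability[OF W n h, of J] card by (simp add: J_def)
qed

text \<open>Reflection permutes the indices and so preserves the size of complements.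
  \<open>W\<close> and \<open>W'\<close> may be dependent in any way, since only their separate laws
  are compared; they will be the waiting times of the walled and of the free system.\<close>

lemma reflected_attempts_law:
  assumes W: "waiting_times M W" and W': "waiting_times M W'" and n: "0 < n" and h: "0 \<le> h"
  shows "prob {\<omega> \<in> space M. attempted_cells n N h (\<lambda>m. attempt_times (\<lambda>k. W m k \<omega>)) \<in> F} =
    prob {\<omega> \<in> space M. (\<lambda>p. N * n - Suc p) ` attempted_cells n N h (\<lambda>m. attempt_times (\<lambda>k. W' m k \<omega>)) \<in> F}"
proof (rule finite_random_set_law_eq)
  let ?r = "\<lambda>p. N * n - Suc p" and ?I = "{..<N * n}"
  let ?X = "\<lambda>\<omega>. attempted_cells n N h (\<lambda>m. attempt_times (\<lambda>k. W m k \<omega>))"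
  let ?Y = "\<lambda>\<omega>. attempted_cells n N h (\<lambda>m. attempt_times (\<lambda>k. W' m k \<omega>))"
  have Wm: "W m k \<in> borel_measurable M" "W' m k \<in> borel_measurable M" if "m \<in> {1..n}" for m k
    using that waiting_times_distributed[OF W, of m k] waiting_times_distributed[OF W', of m k]
    by (auto dest: distributed_measurable)
  show "finite ?I" by simp
  show "?X \<in> measurable M (count_space (Pow ?I))"
    by (rule measurable_attempted_cells) (use Wm in auto)
  have "?Y \<in> measurable M (count_space (Pow ?I))"
    by (rule measurable_attempted_cells) (use Wm in auto)
  moreover have "(\<lambda>S. ?r ` S) \<in> measurable (count_space (Pow ?I)) (count_space (Pow ?I))" by auto
  ultimately show "(\<lambda>\<omega>. ?r ` ?Y \<omega>) \<in> measurable M (count_space (Pow ?I))"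
    by (rule measurable_compose)
  fix S assume S: "S \<subseteq> ?I"
  have rr: "?r (?r p) = p" if "p \<in> ?I" for p using that by auto
  have "?Y \<omega> \<subseteq> ?I" for \<omega> by (auto simp: attempted_cells_def)
  have "?r ` Y \<subseteq> S \<longleftrightarrow> Y \<subseteq> ?r ` S" if Y: "Y \<subseteq> ?I" for Y
  proof
    assume YS: "?r ` Y \<subseteq> S"
    show "Y \<subseteq> ?r ` S"
    proof
      fix p assume "p \<in> Y"
      then have "?r p \<in> S" "?r (?r p) = p" using YS rr Y by blast+
      then show "p \<in> ?r ` S" by (metis imageI)
    qed
  next
    assume YS: "Y \<subseteq> ?r ` S"
    show "?r ` Y \<subseteq> S"
    proof
      fix p assume "p \<in> ?r ` Y"
      then obtain q where "q \<in> S" "p = ?r (?r q)" using YS by blast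
      moreover then have "?r (?r q) = q" using S by (intro rr) blast
      ultimately show "p \<in> S" by simp
    qed
  qed
  from this[OF \<open>\<And>\<omega>. ?Y \<omega> \<subseteq> ?I\<close>] have "?r ` ?Y \<omega> \<subseteq> S \<longleftrightarrow> ?Y \<omega> \<subseteq> ?r ` S" for \<omega> .
  moreover have rS: "?r ` S \<subseteq> ?I"
  proof
    fix p assume "p \<in> ?r ` S"
    then obtain q where "q \<in> S" "p = ?r q" by blast
    moreover have "q < N * n" using S \<open>q \<in> S\<close> by blast
    ultimately show "p \<in> ?I" by simp
  qed
  ultimately have "prob {\<omega> \<in> space M. ?r ` ?Y \<omega> \<subseteq> S} = exp (- (h * card (?I - ?r ` S)))"
    using attempted_cells_subset_prob[OF W' n h rS] by simp
  moreover have "inj_on ?r ?I" using rr by (rule inj_on_inverseI)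
  then have "card (?r ` S) = card S" using S by (intro card_image) (rule inj_on_subset)
  then have "card (?I - ?r ` S) = card (?I - S)"
    using S finite_subset[OF S] by (subst (1 2) card_Diff_subset) auto
  ultimately show "prob {\<omega> \<in> space M. ?X \<omega> \<subseteq> S} = prob {\<omega> \<in> space M. ?r ` ?Y \<omega> \<subseteq> S}"
    using attempted_cells_subset_prob[OF W n h S] by simp
qed

end

section \<open>Refining the grid\<close>

text \<open>Dominated convergence of indicators. How fine the grid must be depends on \<omega>, so
  the pathwise agreement yields a limit of probabilities rather than an equality for some N.\<close>

lemma (in prob_space) prob_tendsto_of_eventually:
  assumes A: "\<And>N. A N \<in> events" and B: "B \<in> events"
    and ev: "AE \<omega> in M. \<forall>\<^sub>F N in sequentially. \<omega> \<in> A N \<longleftrightarrow> \<omega> \<in> B"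
  shows "(\<lambda>N. prob (A N)) \<longlonglongrightarrow> prob B"
proof -
  have "(\<lambda>N. \<integral>\<omega>. indicator (A N) \<omega> \<partial>M) \<longlonglongrightarrow> (\<integral>\<omega>. indicator B \<omega> \<partial>M :: real)"
  proof (rule integral_dominated_convergence[where w = "\<lambda>_. 1"])
    show "AE \<omega> in M. (\<lambda>N. indicator (A N) \<omega> :: real) \<longlonglongrightarrow> indicator B \<omega>"
      using ev
    proof eventually_elim
      case (elim \<omega>)
      then have "\<forall>\<^sub>F N in sequentially. (indicator (A N) \<omega> :: real) = indicator B \<omega>"
        by eventually_elim (simp add: indicator_def)
      then show ?case by (rule tendsto_eventually)
    qed
  qed (use A B in auto)
  then show ?thesis using A B by (simp add: Int_absorb1 sets.sets_into_space)
qed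

lemma (in prob_space) waiting_times_measurable:
  assumes "waiting_times M W" "1 \<le> m"
  shows "W m k \<in> borel_measurable M"
  using distributed_measurable[OF waiting_times_distributed[OF assms]] by simp

lemma (in prob_space) no_common_attempts:
  assumes W: "waiting_times M W" and m: "1 \<le> m" "1 \<le> m'" "m \<noteq> m'" and T: "0 \<le> T"
  shows "AE \<omega> in M. attempt_times (\<lambda>k. W m k \<omega>) \<inter> attempt_times (\<lambda>k. W m' k \<omega>) \<inter> {0<..T} = {}"
proof -
  let ?A = "\<lambda>m \<omega>. attempt_times (\<lambda>k. W m k \<omega>)"
  have [measurable]: "W l k \<in> borel_measurable M" if "l \<in> {m, m'}" for l k
    using that m by (auto intro: waiting_times_measurable[OF W])
  have [measurable]: "W m k \<in> borel_measurable M" "W m' k \<in> borel_measurable M" for k by auto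
  define C where "C = {\<omega> \<in> space M. \<exists>k k'. (\<Sum>i\<le>k. W m i \<omega>) = (\<Sum>i\<le>k'. W m' i \<omega>) \<and>
    0 < (\<Sum>i\<le>k. W m i \<omega>) \<and> (\<Sum>i\<le>k. W m i \<omega>) \<le> T}"
  have [measurable]: "C \<in> events" unfolding C_def by measurable
  have C: "C = {\<omega> \<in> space M. ?A m \<omega> \<inter> ?A m' \<omega> \<inter> {0<..T} \<noteq> {}}"
  proof -
    have "(\<exists>k k'. a k = b k' \<and> 0 < a k \<and> a k \<le> T) \<longleftrightarrow> range a \<inter> range b \<inter> {0<..T} \<noteq> {}"
      for a b :: "nat \<Rightarrow> real"
    proof
      assume "\<exists>k k'. a k = b k' \<and> 0 < a k \<and> a k \<le> T"
      then obtain k k' where "a k = b k'" "0 < a k" "a k \<le> T" by blast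
      then have "a k \<in> range b" "a k \<in> {0<..T}" by simp_all
      then have "a k \<in> range a \<inter> range b \<inter> {0<..T}" by blast
      then show "range a \<inter> range b \<inter> {0<..T} \<noteq> {}" by blast
    qed auto
    then show ?thesis unfolding C_def attempt_times_def by simp
  qed
  define n where "n = max m m'"
  have n: "0 < n" "m \<in> {1..n}" "m' \<in> {1..n}" using m by (auto simp: n_def)
  have bound: "prob C \<le> T\<^sup>2 / real N" if N: "0 < N" for N
  proof -
    define h where "h = T / real N"
    have h: "0 \<le> h" using T by (simp add: h_def)
    let ?E = "\<lambda>l i. {\<omega> \<in> space M. ?A l \<omega> \<inter> grid_cell h i = {}}"
    have E: "?E l i \<in> events" if "l \<in> {m, m'}" for l i
    proof -
      have "?E l i = {\<omega> \<in> space M. \<forall>k. (\<Sum>j\<le>k. W l j \<omega>) \<notin> grid_cell h i}"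
        by (auto simp: attempt_times_def)
      moreover have [measurable]: "grid_cell h i \<in> sets borel" by (simp add: grid_cell_def)
      have [measurable]: "W l k \<in> borel_measurable M" for k using that by auto
      have "{\<omega> \<in> space M. \<forall>k. (\<Sum>j\<le>k. W l j \<omega>) \<notin> grid_cell h i} \<in> events" by measurable
      ultimately show ?thesis by simp
    qed
    define G where "G i = space M - (?E m i \<union> ?E m' i)" for i
    have both: "prob (G i) \<le> h\<^sup>2" for i
    proof -
      \<comment> \<open>Empty index sets for all other labels reduce the joint formula to the label
        in question; the same device gives the pair below.\<close>
      have single: "prob (?E l i) = exp (- h)" if "l \<in> {m, m'}" for l
      proof -
        have "?E l i = {\<omega> \<in> space M. \<forall>a\<in>{1..n}. \<forall>b\<in>(if a = l then {i} else {}). ?A a \<omega> \<inter> grid_cell h b = {}}"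
          using that n by auto
        moreover have "(\<Sum>a=1..n. card (if a = l then {i} else {})) = (\<Sum>a\<in>{1..n}. if a = l then 1 else 0)"
          by (intro sum.cong) auto
        then have "(\<Sum>a=1..n. card (if a = l then {i} else {})) = 1" using that n by auto
        ultimately show ?thesis
          using joint_void_probability[OF W n(1) h, of "\<lambda>a. if a = l then {i} else {}"] by simp
      qed
      have "?E m i \<inter> ?E m' i =
          {\<omega> \<in> space M. \<forall>a\<in>{1..n}. \<forall>b\<in>(if a = m \<or> a = m' then {i} else {}). ?A a \<omega> \<inter> grid_cell h b = {}}"
        using n by auto
      moreover have "(\<Sum>a=1..n. card (if a = m \<or> a = m' then {i} else {})) =
          (\<Sum>a\<in>{1..n}. (if a = m then 1 else 0) + (if a = m' then 1 else 0))"
        using m by (intro sum.cong) auto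
      then have "(\<Sum>a=1..n. card (if a = m \<or> a = m' then {i} else {})) = 2"
        using n by (simp add: sum.distrib)
      ultimately have "prob (?E m i \<inter> ?E m' i) = exp (- (h * 2))"
        using joint_void_probability[OF W n(1) h, of "\<lambda>a. if a = m \<or> a = m' then {i} else {}"] by simp
      also have "\<dots> = (exp (- h))\<^sup>2" by (simp add: exp_double[symmetric] mult.commute)
      finally have "prob (?E m i \<union> ?E m' i) = 2 * exp (- h) - (exp (- h))\<^sup>2"
        using measure_Un3[of "?E m i" M "?E m' i"] E[of m i] E[of m' i] single[of m] single[of m']
        by (simp add: fmeasurable_eq_sets)
      \<comment> \<open>Inclusion-exclusion gives 1 - 2 exp (- h) + exp (- 2 h), a perfect
        square.\<close>
      then have "prob (G i) = (1 - exp (- h))\<^sup>2"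
        unfolding G_def using E[of m i] E[of m' i] by (subst prob_compl) (auto simp: power2_eq_square algebra_simps)
      also have "\<dots> \<le> h\<^sup>2" using h exp_ge_add_one_self[of "- h"] by (intro power_mono) auto
      finally show ?thesis .
    qed
    \<comment> \<open>Both particles attempt in the same cell with probability at most \<open>h\<^sup>2\<close>; sum over the \<open>N\<close> cells.\<close>
    have "C \<subseteq> (\<Union>i<N. G i)"
    proof
      fix \<omega> assume \<omega>: "\<omega> \<in> C"
      then obtain t where t: "t \<in> ?A m \<omega>" "t \<in> ?A m' \<omega>" "0 < t" "t \<le> T" by (auto simp: C)
      then have hp: "0 < h" using N by (simp add: h_def)
      \<comment> \<open>Ceiling minus one instead of the floor, since a point on a grid line belongs
        to the cell that ends there.\<close>
      define i where "i = nat (\<lceil>t / h\<rceil> - 1)"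
      have c: "0 < \<lceil>t / h\<rceil>" using t hp by simp
      have ri: "real i = of_int \<lceil>t / h\<rceil> - 1" using c by (simp add: i_def)
      have "real i < t / h" "t / h \<le> real i + 1" unfolding ri by linarith+
      then have ti: "real i * h < t" "t \<le> real (Suc i) * h" using hp by (auto simp: field_simps)
      have "real i * h < real N * h" using ti t N by (simp add: h_def)
      then have "i < N" using hp by simp
      moreover have "t \<in> grid_cell h i" using ti by (simp add: grid_cell_def)
      ultimately show "\<omega> \<in> (\<Union>i<N. G i)" using t \<omega> by (auto simp: C G_def)
    qed
    moreover have ev: "G i \<in> events" for i unfolding G_def using E by auto
    ultimately have "prob C \<le> prob (\<Union>i<N. G i)"
      by (intro finite_measure_mono sets.finite_UN) simp_all
    also have "\<dots> \<le> (\<Sum>i<N. prob (G i))"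
      using ev by (intro finite_measure_subadditive_finite image_subsetI finite_lessThan)
    also have "\<dots> \<le> (\<Sum>i<N. h\<^sup>2)" by (intro sum_mono both)
    also have "\<dots> = T\<^sup>2 / real N" using N by (simp add: h_def power2_eq_square)
    finally show ?thesis .
  qed
  have "(\<lambda>N. T\<^sup>2 / real N) \<longlonglongrightarrow> 0" by (rule lim_const_over_n)
  then have "prob C \<le> 0" by (rule LIMSEQ_le_const) (use bound in \<open>auto intro: exI[of _ 1]\<close>)
  then have "emeasure M C = 0" by (simp add: emeasure_eq_measure measure_le_0_iff)
  moreover have "{\<omega> \<in> space M. \<not> (?A m \<omega> \<inter> ?A m' \<omega> \<inter> {0<..T} = {})} = C" unfolding C by simp
  ultimately show ?thesis by (subst AE_iff_measurable[OF \<open>C \<in> events\<close>]) auto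
qed

lemma (in prob_space) attempts_locally_finite:
  assumes W: "waiting_times M W"
  shows "AE \<omega> in M. \<forall>m\<ge>1. \<forall>t. finite (attempt_times (\<lambda>k. W m k \<omega>) \<inter> {0<..t})"
proof -
  have "AE \<omega> in M. \<forall>t. finite (attempt_times (\<lambda>k. W m k \<omega>) \<inter> {0<..t})" if "1 \<le> m" for m
    using exponential_sums_at_top[OF waiting_times_row[OF W that] waiting_times_distributed[OF W that]]
  proof eventually_elim
    case (elim \<omega>)
    show ?case
    proof
      fix t
      have "eventually (\<lambda>k. t < (\<Sum>i<k. W m i \<omega>)) sequentially"
        using elim by (auto simp: filterlim_at_top_dense)
      then obtain k where k: "\<And>j. j \<ge> k \<Longrightarrow> t < (\<Sum>i<j. W m i \<omega>)"
        by (auto simp: eventually_sequentially)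
      have "attempt_times (\<lambda>k. W m k \<omega>) \<inter> {0<..t} \<subseteq> (\<lambda>j. \<Sum>i\<le>j. W m i \<omega>) ` {..<k}"
      proof
        fix u assume "u \<in> attempt_times (\<lambda>k. W m k \<omega>) \<inter> {0<..t}"
        then obtain j where j: "u = (\<Sum>i\<le>j. W m i \<omega>)" "u \<le> t" by (auto simp: attempt_times_def)
        then have "j < k" using k[of "Suc j"] by (force simp: lessThan_Suc_atMost)
        then show "u \<in> (\<lambda>j. \<Sum>i\<le>j. W m i \<omega>) ` {..<k}" using j by auto
      qed
      then show "finite (attempt_times (\<lambda>k. W m k \<omega>) \<inter> {0<..t})" by (rule finite_subset) simp
    qed
  qed
  then have "AE \<omega> in M. \<forall>m. 1 \<le> m \<longrightarrow> (\<forall>t. finite (attempt_times (\<lambda>k. W m k \<omega>) \<inter> {0<..t}))"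
    by (subst AE_all_countable) (auto intro: AE_I2)
  then show ?thesis .
qed

section \<open>Cells shorter than every relevant gap\<close>

lemma eventually_mesh_less:
  fixes T d :: real
  assumes "0 < d"
  shows "\<forall>\<^sub>F N in sequentially. T / real N < d"
  using order_tendstoD(2)[OF lim_const_over_n[of T] assms] .

lemma grid_cell_mesh:
  assumes "t \<in> grid_cell (T / real N) i" "i < N" "0 \<le> T"
  shows "0 < t" "t \<le> T"
proof -
  have "real (Suc i) * (T / real N) \<le> real N * (T / real N)"
    using assms by (intro mult_right_mono) auto
  moreover have "0 \<le> real i * (T / real N)" using assms by simp
  moreover have "real i * (T / real N) < t" "t \<le> real (Suc i) * (T / real N)"
    using assms(1) by (auto simp: grid_cell_def)
  moreover have "real N * (T / real N) = T" using assms by simp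
  ultimately show "0 < t" "t \<le> T" by linarith+
qed

lemma grid_cell_dist:
  assumes "t \<in> grid_cell h i" "t' \<in> grid_cell h i"
  shows "\<bar>t - t'\<bar> < h"
  using assms by (auto simp: grid_cell_def algebra_simps)

text \<open>Up to T there are finitely many attempts of labels 1 to \<open>n\<close>, at pairwise
  different times. Once the mesh is below all their distances, no cell contains two of them.\<close>

lemma eventually_attempts_separated:
  assumes T: "0 \<le> T"
    and fin: "\<And>m. m \<in> {1..n} \<Longrightarrow> finite (A m \<inter> {0<..T})"
    and disj: "\<And>m m'. m \<in> {1..n} \<Longrightarrow> m' \<in> {1..n} \<Longrightarrow> m \<noteq> m' \<Longrightarrow> A m \<inter> A m' \<inter> {0<..T} = {}"
  shows "\<forall>\<^sub>F N in sequentially. attempts_separated n N (T / real N) A"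
proof -
  define P where "P = (SIGMA m:{1..n}. A m \<inter> {0<..T})"
  have P: "finite P" unfolding P_def using fin by (intro finite_SigmaI) auto
  have "\<forall>\<^sub>F N in sequentially. a = b \<or> T / real N < \<bar>snd a - snd b\<bar>" if "a \<in> P" "b \<in> P" for a b
  proof (cases "a = b")
    case False
    then have "snd a \<noteq> snd b" using that disj by (fastforce simp: P_def)
    then have "\<forall>\<^sub>F N in sequentially. T / real N < \<bar>snd a - snd b\<bar>"
      by (intro eventually_mesh_less) simp
    then show ?thesis by eventually_elim simp
  qed simp
  then have "\<forall>\<^sub>F N in sequentially. \<forall>a\<in>P. \<forall>b\<in>P. a = b \<or> T / real N < \<bar>snd a - snd b\<bar>"
    by (intro eventually_ball_finite P ballI)
  then show ?thesis
  proof eventually_elim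
    case (elim N)
    show ?case unfolding attempts_separated_def
    proof (intro allI impI ballI)
      fix i m m' t t'
      assume *: "i < N" "m \<in> {1..n}" "m' \<in> {1..n}" "t \<in> A m \<inter> grid_cell (T / real N) i"
        "t' \<in> A m' \<inter> grid_cell (T / real N) i"
      have "(m, t) \<in> P" "(m', t') \<in> P"
        using * grid_cell_mesh[OF _ *(1) T] by (auto simp: P_def)
      moreover have "\<bar>t - t'\<bar> < T / real N" using * by (intro grid_cell_dist) auto
      ultimately show "m = m' \<and> t = t'" using elim by fastforce
    qed
  qed
qed

text \<open>Monotonicity keeps f u from dropping below f t, and right-continuity keeps it below the
  next integer for a while.\<close>

lemma floor_right_constant:
  fixes f :: "real \<Rightarrow> real"
  assumes f: "mono_on {0..} f" "cadlag f" and t: "0 \<le> t"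
  obtains d where "0 < d" "\<And>u. t \<le> u \<Longrightarrow> u < t + d \<Longrightarrow> \<lfloor>f u\<rfloor> = \<lfloor>f t\<rfloor>"
proof -
  have "(f \<longlongrightarrow> f t) (at_right t)"
    using f(2) t by (simp add: cadlag_def continuous_within)
  moreover have "f t < of_int \<lfloor>f t\<rfloor> + 1" by linarith
  ultimately have "\<forall>\<^sub>F u in at_right t. f u < of_int \<lfloor>f t\<rfloor> + 1" by (rule order_tendstoD)
  then obtain b where b: "t < b" "\<And>u. t < u \<Longrightarrow> u < b \<Longrightarrow> f u < of_int \<lfloor>f t\<rfloor> + 1"
    unfolding eventually_at_right_field by auto
  show thesis
  proof (rule that[of "b - t"])
    fix u assume u: "t \<le> u" "u < t + (b - t)"
    then have "f t \<le> f u" using t by (intro mono_onD[OF f(1)]) auto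
    moreover have "f u < of_int \<lfloor>f t\<rfloor> + 1" using u b(2)[of u] \<open>f t < _\<close> by (cases "u = t") auto
    ultimately show "\<lfloor>f u\<rfloor> = \<lfloor>f t\<rfloor>" by (simp add: floor_eq_iff) linarith
  qed (use b in simp)
qed

text \<open>This is why the discrete wall of cell i is read at the right end of the cell: that end
  lies less than one mesh width after the attempt, where the floor of \<open>f\<close> has not yet
  changed. The left end precedes the attempt and may lie before a jump of \<open>f\<close>.\<close>

lemma eventually_wall_constant:
  fixes f :: "real \<Rightarrow> real" and A :: "nat \<Rightarrow> real set"
  assumes f: "mono_on {0..} f" "cadlag f" and T: "0 \<le> T"
    and fin: "\<And>m. m \<in> {1..n} \<Longrightarrow> finite (A m \<inter> {0<..T})"
  shows "\<forall>\<^sub>F N in sequentially. \<forall>i<N. \<forall>m\<in>{1..n}. \<forall>t\<in>A m \<inter> grid_cell (T / real N) i.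
    \<lfloor>f (real (Suc i) * (T / real N))\<rfloor> = \<lfloor>f t\<rfloor>"
proof -
  define P where "P = (\<Union>m\<in>{1..n}. A m \<inter> {0<..T})"
  have P: "finite P" unfolding P_def by (rule finite_UN_I[OF finite_atLeastAtMost fin])
  have "\<forall>\<^sub>F N in sequentially. \<forall>u. t \<le> u \<longrightarrow> u < t + T / real N \<longrightarrow> \<lfloor>f u\<rfloor> = \<lfloor>f t\<rfloor>" if "t \<in> P" for t
  proof -
    have t: "0 \<le> t" using that by (auto simp: P_def)
    obtain d where d: "0 < d" "\<And>u. t \<le> u \<Longrightarrow> u < t + d \<Longrightarrow> \<lfloor>f u\<rfloor> = \<lfloor>f t\<rfloor>"
      using floor_right_constant[OF f t] by blast
    show ?thesis using eventually_mesh_less[OF d(1), of T]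
    proof eventually_elim
      case (elim N)
      show ?case by (intro allI impI d(2)) (use elim in linarith)+
    qed
  qed
  then have "\<forall>\<^sub>F N in sequentially. \<forall>t\<in>P. \<forall>u. t \<le> u \<longrightarrow> u < t + T / real N \<longrightarrow> \<lfloor>f u\<rfloor> = \<lfloor>f t\<rfloor>"
    by (intro eventually_ball_finite P ballI)
  then show ?thesis
  proof eventually_elim
    case (elim N)
    show ?case
    proof (intro allI impI ballI)
      fix i m t assume *: "i < N" "m \<in> {1..n}" "t \<in> A m \<inter> grid_cell (T / real N) i"
      then have "t \<in> P" using grid_cell_mesh[OF _ *(1) T] by (auto simp: P_def)
      moreover have "t \<le> real (Suc i) * (T / real N)" "real i * (T / real N) < t"
        using * by (simp_all only: grid_cell_def Int_iff greaterThanAtMost_iff)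
      moreover have "real (Suc i) * (T / real N) = real i * (T / real N) + T / real N"
        by (simp only: of_nat_Suc distrib_right mult_1_left add.commute)
      moreover from calculation have "real (Suc i) * (T / real N) < t + T / real N" by linarith
      ultimately show "\<lfloor>f (real (Suc i) * (T / real N))\<rfloor> = \<lfloor>f t\<rfloor>" using elim by blast
    qed
  qed
qed

section \<open>Both systems and the right-hand event along a fine grid\<close>

lemma eventually_run_eq_wall_path:
  fixes x :: "nat \<Rightarrow> real \<Rightarrow> int" and f :: "real \<Rightarrow> real"
  assumes ev: "tasep_evolution (\<lambda>t y. real_of_int y \<le> f t) A x" and n: "0 < n" and T: "0 \<le> T"
    and f: "mono_on {0..} f" "cadlag f"
    and fin: "\<forall>m\<ge>1. \<forall>t. finite (A m \<inter> {0<..t})"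
    and disj: "\<forall>m\<in>{1..n}. \<forall>m'\<in>{1..n}. m \<noteq> m' \<longrightarrow> A m \<inter> A m' \<inter> {0<..T} = {}"
    and init: "\<forall>m\<ge>1. x (m + 1) 0 < x m 0" and c: "\<forall>m\<in>{1..n}. c m = x m 0"
  shows "\<forall>\<^sub>F N in sequentially. run n (\<lambda>i y. y \<le> \<lfloor>f (real (Suc i) * (T / real N))\<rfloor>)
    (attempted_cells n N (T / real N) A) c (N * n) n = x n T"
proof -
  have finT: "finite (A m \<inter> {0<..T})" if "m \<in> {1..n}" for m using fin that by auto
  have order: "\<forall>m\<ge>1. \<forall>t\<ge>0. x (m + 1) t < x m t"
    using evolution_order[OF ev] fin init by blast
  have "\<forall>\<^sub>F N in sequentially. attempts_separated n N (T / real N) A"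
    by (rule eventually_attempts_separated[OF T finT]) (use disj in blast)+
  moreover have "\<forall>\<^sub>F N in sequentially. \<forall>i<N. \<forall>m\<in>{1..n}. \<forall>t\<in>A m \<inter> grid_cell (T / real N) i.
      \<lfloor>f (real (Suc i) * (T / real N))\<rfloor> = \<lfloor>f t\<rfloor>"
    by (rule eventually_wall_constant[OF f T finT])
  moreover have "\<forall>\<^sub>F N in sequentially. 0 < N" by (rule eventually_gt_at_top)
  ultimately show ?thesis
  proof eventually_elim
    case (elim N)
    let ?ok = "\<lambda>i y. y \<le> \<lfloor>f (real (Suc i) * (T / real N))\<rfloor>"
    have ok: "\<forall>i<N. \<forall>m\<in>{1..n}. \<forall>t\<in>A m \<inter> grid_cell (T / real N) i. (\<lambda>y. real_of_int y \<le> f t) = ?ok i"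
      using elim(2) by (auto simp: le_floor_iff)
    have "run n ?ok (attempted_cells n N (T / real N) A) c (N * n) n = x n (real N * (T / real N))"
      using n T by (intro run_eq_evolution(1)[OF ev _ n order elim(1) ok c]) auto
    with elim(3) show ?case by simp
  qed
qed

lemma eventually_run_eq_free_path:
  fixes x :: "nat \<Rightarrow> real \<Rightarrow> int"
  assumes ev: "tasep_evolution (\<lambda>t y. True) A x" and n: "0 < n" and T: "0 \<le> T"
    and fin: "\<forall>m\<ge>1. \<forall>t. finite (A m \<inter> {0<..t})"
    and disj: "\<forall>m\<in>{1..n}. \<forall>m'\<in>{1..n}. m \<noteq> m' \<longrightarrow> A m \<inter> A m' \<inter> {0<..T} = {}"
    and init: "\<forall>m\<ge>1. x m 0 = - (int m - 1)"
  shows "\<forall>\<^sub>F N in sequentially.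
    (\<forall>k\<in>{1..n}. run n (\<lambda>i y. True) (attempted_cells n N (T / real N) A) (\<lambda>m. 1 - int m) (N * n) k = x k T) \<and>
    (\<forall>p<N * n. run n (\<lambda>i y. True) (attempted_cells n N (T / real N) A) (\<lambda>m. 1 - int m) p n =
       x n (real (p div n) * (T / real N)))"
proof -
  have finT: "finite (A m \<inter> {0<..T})" if "m \<in> {1..n}" for m using fin that by auto
  have init': "x (m + 1) 0 < x m 0" if "1 \<le> m" for m using init that by simp
  have order: "\<forall>m\<ge>1. \<forall>t\<ge>0. x (m + 1) t < x m t"
    using evolution_order[OF ev] fin init' by blast
  have "\<forall>\<^sub>F N in sequentially. attempts_separated n N (T / real N) A"
    by (rule eventually_attempts_separated[OF T finT]) (use disj in blast)+
  moreover have "\<forall>\<^sub>F N in sequentially. 0 < N" by (rule eventually_gt_at_top)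
  ultimately show ?thesis
  proof eventually_elim
    case (elim N)
    have ok: "\<forall>i<N. \<forall>m\<in>{1..n}. \<forall>t\<in>A m \<inter> grid_cell (T / real N) i. (\<lambda>y. True) = (\<lambda>y::int. True)" by simp
    have c: "\<forall>m\<in>{1..n}. 1 - int m = x m 0" using init by simp
    have h: "0 \<le> T / real N" using T by simp
    note * = run_eq_evolution[OF ev h n order elim(1) ok c]
    have "run n (\<lambda>i y. True) (attempted_cells n N (T / real N) A) (\<lambda>m. 1 - int m) (N * n) k = x k T"
      if "k \<in> {1..n}" for k
      using *(1)[OF order_refl that] elim(2) by simp
    with *(2) show ?case by blast
  qed
qed

text \<open>Only finitely many values of the path enter, so the condition is measurable and can be
  read off \<open>trajectories\<close>. The index i = N is included so that the grid contains both
  ends of [0, T].\<close>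

definition grid_condition ::
  "nat \<Rightarrow> nat \<Rightarrow> real \<Rightarrow> (real \<Rightarrow> real) \<Rightarrow> int \<Rightarrow> (nat \<Rightarrow> int) \<Rightarrow> (nat \<Rightarrow> real \<Rightarrow> int) \<Rightarrow> bool" where
  "grid_condition n N T f s c x \<longleftrightarrow>
     (\<forall>i\<le>N. x n (real i * (T / real N)) > s - \<lfloor>f (T - real i * (T / real N))\<rfloor>) \<and>
     (\<forall>k\<in>{1..n}. x k T > s - c (n + 1 - k))"

lemma eventually_grid_condition_iff_run:
  fixes x :: "nat \<Rightarrow> real \<Rightarrow> int" and f :: "real \<Rightarrow> real"
  assumes ev: "tasep_evolution (\<lambda>t y. True) A x" and n: "0 < n" and T: "0 \<le> T"
    and f: "mono_on {0..} f" "\<forall>t\<ge>0. 0 \<le> f t"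
    and fin: "\<forall>m\<ge>1. \<forall>t. finite (A m \<inter> {0<..t})"
    and disj: "\<forall>m\<in>{1..n}. \<forall>m'\<in>{1..n}. m \<noteq> m' \<longrightarrow> A m \<inter> A m' \<inter> {0<..T} = {}"
    and init: "\<forall>m\<ge>1. x m 0 = - (int m - 1)" and c: "packed n c" "c 1 \<le> 0"
  shows "\<forall>\<^sub>F N in sequentially. grid_condition n N T f s c x \<longleftrightarrow>
    s < run n (\<lambda>i y. y \<le> \<lfloor>f (real (Suc i) * (T / real N))\<rfloor>)
      ((\<lambda>p. N * n - Suc p) ` attempted_cells n N (T / real N) A) c (N * n) n"
  using eventually_run_eq_free_path[OF ev n T fin disj init] eventually_gt_at_top[of 0]
proof eventually_elim
  case (elim N)
  define h where "h = T / real N"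
  let ?g = "\<lambda>i. \<lfloor>f (real (Suc i) * h)\<rfloor>" and ?r = "\<lambda>p. N * n - Suc p"
  let ?S = "attempted_cells n N h A"
  have h: "0 \<le> h" using T by (simp add: h_def)
  have "mono ?g"
  proof (intro monoI floor_mono mono_onD[OF f(1)])
    fix i j :: nat assume "i \<le> j"
    then show "real (Suc i) * h \<le> real (Suc j) * h" using h by (intro mult_right_mono) auto
  qed (use h in auto)
  moreover have "c 1 \<le> ?g 0" using c(2) f(2) h by (auto intro: order_trans)
  moreover have S: "?S \<subseteq> {..<N * n}" by (auto simp: attempted_cells_def)
  then have "?r (?r p) = p" if "p \<in> ?S" for p using that by auto
  \<comment> \<open>The walled run receives the reflected set. Reflecting again returns the free
    system's own set, as \<open>run_duality\<close> requires.\<close>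
  then have "?S = ?r ` ?r ` ?S" by (simp add: image_image cong: image_cong)
  moreover have "?r ` ?S \<subseteq> {..<N * n}" using S by auto
  ultimately have "s < run n (\<lambda>i y. y \<le> ?g i) (?r ` ?S) c (N * n) n \<longleftrightarrow>
    (\<forall>k\<in>{1..n}. s < run n (\<lambda>i y. True) ?S (\<lambda>m. 1 - int m) (N * n) k + c (n + 1 - k)) \<and>
    (\<forall>p<N * n. s < run n (\<lambda>i y. True) ?S (\<lambda>m. 1 - int m) p n + ?g (N - 1 - p div n))"
    by (intro run_duality n c(1))
  also have "\<dots> \<longleftrightarrow> (\<forall>k\<in>{1..n}. s < x k T + c (n + 1 - k)) \<and>
    (\<forall>p<N * n. s < x n (real (p div n) * h) + ?g (N - 1 - p div n))"
    using elim(1) by (simp add: h_def)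
  also have "(\<forall>p<N * n. s < x n (real (p div n) * h) + ?g (N - 1 - p div n)) \<longleftrightarrow>
    (\<forall>i<N. s < x n (real i * h) + ?g (N - 1 - i))"
  proof (intro iffI allI impI)
    fix i assume *: "\<forall>p<N * n. s < x n (real (p div n) * h) + ?g (N - 1 - p div n)" and "i < N"
    then have "i * n < N * n" "i * n div n = i" using n by auto
    with * show "s < x n (real i * h) + ?g (N - 1 - i)" by metis
  next
    fix p assume *: "\<forall>i<N. s < x n (real i * h) + ?g (N - 1 - i)" and "p < N * n"
    then have "p div n < N" by (simp add: less_mult_imp_div_less)
    with * show "s < x n (real (p div n) * h) + ?g (N - 1 - p div n)" by blast
  qed
  also have "\<dots> \<longleftrightarrow> (\<forall>i<N. s < x n (real i * h) + \<lfloor>f (T - real i * h)\<rfloor>)"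
  proof -
    \<comment> \<open>The right end of the mirrored cell N - 1 - i is exactly T - i * h, so reading
      the wall at right ends matches the free path read at left ends.\<close>
    have "real (Suc (N - 1 - i)) * h = T - real i * h" if "i < N" for i
    proof -
      have "real (Suc (N - 1 - i)) = real N - real i" using that by (simp add: of_nat_diff)
      moreover have "real N * h = T" using elim(2) by (simp add: h_def)
      ultimately show ?thesis by (simp only: left_diff_distrib)
    qed
    then show ?thesis by simp
  qed
  finally have "s < run n (\<lambda>i y. y \<le> ?g i) (?r ` ?S) c (N * n) n \<longleftrightarrow>
    (\<forall>k\<in>{1..n}. s < x k T + c (n + 1 - k)) \<and> (\<forall>i<N. s < x n (real i * h) + \<lfloor>f (T - real i * h)\<rfloor>)" .
  \<comment> \<open>The duality stops at i < N. The inequality at time T follows from the pair k =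
    n, because c 1 \<le> 0 and f 0 \<ge> 0.\<close>
  moreover have "s < x n (real N * h) + \<lfloor>f (T - real N * h)\<rfloor>"
    if "\<forall>k\<in>{1..n}. s < x k T + c (n + 1 - k)"
  proof -
    have "n \<in> {1..n}" using n by simp
    with that have "s < x n T + c (n + 1 - n)" by blast
    then have "s < x n T + c 1" by simp
    moreover have "0 \<le> \<lfloor>f 0\<rfloor>" using f(2) by simp
    moreover have hT: "real N * h = T" using elim(2) by (simp add: h_def)
    ultimately show ?thesis using c(2) unfolding hT diff_self by linarith
  qed
  ultimately show ?case
    unfolding grid_condition_def h_def[symmetric] le_eq_less_or_eq less_diff_eq diff_less_eq by blast
qed

lemma eventually_grid_condition_iff:
  fixes x :: "nat \<Rightarrow> real \<Rightarrow> int" and f :: "real \<Rightarrow> real"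
  assumes x: "cadlag (x n)" and T: "0 \<le> T"
    and f: "mono_on {0..} f"
  shows "\<forall>\<^sub>F N in sequentially. grid_condition n N T f s c x \<longleftrightarrow>
    (\<forall>t\<in>{0..T}. x n t > s - \<lfloor>f (T - t)\<rfloor>) \<and> (\<forall>k\<in>{1..n}. x k T > s - c (n + 1 - k))"
proof (cases "(\<forall>k\<in>{1..n}. x k T > s - c (n + 1 - k)) \<and> \<not> (\<forall>t\<in>{0..T}. x n t > s - \<lfloor>f (T - t)\<rfloor>)")
  case True
  \<comment> \<open>By right-continuity of \<open>x n\<close> and monotonicity of \<open>f\<close>, a violation at \<open>t < T\<close> persists on \<open>[t, b)\<close>.\<close>
  then obtain t where t: "0 \<le> t" "t \<le> T" "x n t \<le> s - \<lfloor>f (T - t)\<rfloor>" by (auto simp: not_less)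
  show ?thesis
  proof (cases "t = T")
    case tT: True
    have no: "\<not> grid_condition n N T f s c x" if "0 < N" for N
    proof -
      have "real N * (T / real N) = T" using that by simp
      then have "\<not> x n (real N * (T / real N)) > s - \<lfloor>f (T - real N * (T / real N))\<rfloor>"
        using t tT by simp
      then show ?thesis unfolding grid_condition_def by blast
    qed
    from eventually_gt_at_top[of 0] show ?thesis
      by (rule eventually_mono) (use True no in blast)
  next
    case False
    then have tT: "t < T" using t by simp
    have "(x n \<longlongrightarrow> x n t) (at_right t)"
      using x t by (simp add: cadlag_def continuous_within)
    then have "\<forall>\<^sub>F u in at_right t. x n u = x n t" by (simp add: tendsto_discrete)
    then obtain b where b: "t < b" "\<And>u. t < u \<Longrightarrow> u < b \<Longrightarrow> x n u = x n t"
      unfolding eventually_at_right_field by auto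
    have "0 < min (b - t) (T - t)" using b tT by simp
    from eventually_mesh_less[OF this, of T] eventually_gt_at_top[of 0]
    have "\<forall>\<^sub>F N in sequentially. \<not> grid_condition n N T f s c x"
    proof eventually_elim
      case (elim N)
      define h where "h = T / real N"
      have h: "0 < h" using elim(2) tT t by (simp add: h_def)
      \<comment> \<open>The first grid point at or after t; it lies in [t, t + h), hence before both
        b and T.\<close>
      define i where "i = nat \<lceil>t / h\<rceil>"
      have "0 \<le> \<lceil>t / h\<rceil>" using t h by (simp add: order_less_le_trans[of "-1" 0])
      then have ri: "real i = of_int \<lceil>t / h\<rceil>" by (simp add: i_def)
      have "t / h \<le> real i" "real i < t / h + 1" unfolding ri by linarith+
      then have u: "t \<le> real i * h" "real i * h < t + h" using h by (auto simp: field_simps)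
      then have "real i * h < T" "real i * h < b" using elim(1) by (auto simp: h_def)
      then have "real i * h < real N * h" using elim(2) by (simp add: h_def)
      then have "i < N" using h by simp
      have "x n (real i * h) = x n t" using b(2)[of "real i * h"] u \<open>real i * h < b\<close>
        by (cases "real i * h = t") auto
      moreover have "\<lfloor>f (T - real i * h)\<rfloor> \<le> \<lfloor>f (T - t)\<rfloor>"
        using u \<open>real i * h < T\<close> t by (intro floor_mono mono_onD[OF f]) auto
      ultimately have "\<not> x n (real i * h) > s - \<lfloor>f (T - real i * h)\<rfloor>" using t(3) by simp
      with \<open>i < N\<close> show ?case unfolding grid_condition_def h_def by (meson less_imp_le)
    qed
    then show ?thesis by eventually_elim (use True in blast)
  qed
next
  case False
  \<comment> \<open>In the remaining case the equivalence holds for every N: either the terminal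
    inequalities fail on both sides, or the path condition holds on all of [0, T] and so at the grid
    points.\<close>
  have "real i * (T / real N) \<in> {0..T}" if "i \<le> N" for i N
  proof -
    have "real i * (T / real N) \<le> real N * (T / real N)" using that T by (intro mult_right_mono) auto
    also have "\<dots> \<le> T" using T by (cases "N = 0") auto
    finally show ?thesis using T by simp
  qed
  then show ?thesis using False unfolding grid_condition_def
    by (intro always_eventually allI) blast
qed

text \<open>\<open>to_nat\<close> lists the values of \<open>L\<close> as a sequence, so both
  probabilities become series with equal terms. Numbers that encode no value contribute the empty
  set.\<close>

lemma (in prob_space) prob_eq_by_countable_partition:
  fixes L :: "'a \<Rightarrow> 'c::countable"
  assumes A: "\<And>l. {\<omega> \<in> space M. L \<omega> = l \<and> P \<omega>} \<in> events" and B: "\<And>l. {\<omega> \<in> space M. L \<omega> = l \<and> Q \<omega>} \<in> events"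
    and eq: "\<And>l. prob {\<omega> \<in> space M. L \<omega> = l \<and> P \<omega>} = prob {\<omega> \<in> space M. L \<omega> = l \<and> Q \<omega>}"
  shows "prob {\<omega> \<in> space M. P \<omega>} = prob {\<omega> \<in> space M. Q \<omega>}"
proof -
  let ?A = "\<lambda>P i. {\<omega> \<in> space M. to_nat (L \<omega>) = i \<and> P \<omega>}"
  have shape: "(\<exists>l. \<forall>P. ?A P i = {\<omega> \<in> space M. L \<omega> = l \<and> P \<omega>}) \<or> (\<forall>P. ?A P i = {})" for i
  proof (cases "\<exists>l::'c. to_nat l = i")
    case True
    then obtain l :: 'c where "to_nat l = i" by blast
    then have "\<forall>P. ?A P i = {\<omega> \<in> space M. L \<omega> = l \<and> P \<omega>}" by auto
    then show ?thesis by blast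
  qed auto
  have "(\<lambda>i. prob (?A R i)) sums prob {\<omega> \<in> space M. R \<omega>}"
    if R: "\<And>l. {\<omega> \<in> space M. L \<omega> = l \<and> R \<omega>} \<in> events" for R
  proof -
    have "?A R i \<in> events" for i using shape[of i] R by (metis (lifting) sets.empty_sets)
    then have "(\<lambda>i. prob (?A R i)) sums prob (\<Union>i. ?A R i)"
      by (intro finite_measure_UNION) (auto simp: disjoint_family_on_def)
    also have "(\<Union>i. ?A R i) = {\<omega> \<in> space M. R \<omega>}" by auto
    finally show ?thesis .
  qed
  note this[OF A] this[OF B]
  moreover have "prob (?A P i) = prob (?A Q i)" for i using shape[of i] eq by (metis (lifting))
  ultimately show ?thesis by (simp add: sums_unique2)
qed

lemma (in prob_space) indep_rvs_prob:
  assumes "indep_rvs M M1 Y M2 Z" "B1 \<in> sets M1" "B2 \<in> sets M2"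
  shows "prob ((Y -` B1 \<inter> space M) \<inter> (Z -` B2 \<inter> space M)) =
    prob (Y -` B1 \<inter> space M) * prob (Z -` B2 \<inter> space M)"
  using assms unfolding indep_rvs_def by (intro indep_setD) auto

section \<open>The identity\<close>

lemma (in prob_space) regular_attempts:
  assumes W: "waiting_times M W" and T: "0 \<le> T"
  shows "AE \<omega> in M. (\<forall>m\<ge>1. \<forall>t. finite (attempt_times (\<lambda>k. W m k \<omega>) \<inter> {0<..t})) \<and>
    (\<forall>m\<in>{1..n}. \<forall>m'\<in>{1..n}. m \<noteq> m' \<longrightarrow>
      attempt_times (\<lambda>k. W m k \<omega>) \<inter> attempt_times (\<lambda>k. W m' k \<omega>) \<inter> {0<..T} = {})"
proof -
  have "AE \<omega> in M. \<forall>m\<in>{1..n}. \<forall>m'\<in>{1..n}. m \<noteq> m' \<longrightarrow>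
      attempt_times (\<lambda>k. W m k \<omega>) \<inter> attempt_times (\<lambda>k. W m' k \<omega>) \<inter> {0<..T} = {}"
  proof (intro AE_finite_allI finite_atLeastAtMost)
    fix m m' assume "m \<in> {1..n}" "m' \<in> {1..n}"
    then show "AE \<omega> in M. m \<noteq> m' \<longrightarrow>
        attempt_times (\<lambda>k. W m k \<omega>) \<inter> attempt_times (\<lambda>k. W m' k \<omega>) \<inter> {0<..T} = {}"
      using no_common_attempts[OF W _ _ _ T, of m m'] by (cases "m = m'") auto
  qed
  with attempts_locally_finite[OF W] show ?thesis by eventually_elim blast
qed

text \<open>The floor matters, since integer positions see the wall only through it. For example,
  let \<open>f\<close> jump from 0 to 1/2 at time 1, with T = 2, n = 1, s = 0 and first particle at
  0. The walled particle cannot move, so the left side is 0; with \<open>f\<close> in place of its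
  floor, the right side would be the positive probability that the free particle jumps by time
  1.\<close>

theorem theorem2p1:
  fixes M :: "'a measure"
    and f :: "real \<Rightarrow> real"
    and xf x :: "nat \<Rightarrow> real \<Rightarrow> 'a \<Rightarrow> int"
    and T :: real and n :: nat and s :: int
  assumes "prob_space M"
    and "\<forall>t\<ge>0. 0 \<le> f t" and "mono_on {0..} f" and "cadlag f" and "f 0 = 0"
    and "tasep_with_wall f M xf"
    and "AE \<omega> in M. xf 1 0 \<omega> \<le> 0"
    and "tasep M x" and "step_initial M x"
    and "indep_rvs M
           (PiM {1..} (\<lambda>_. count_space UNIV)) (initial_config xf)
           (PiM ({1..} \<times> {0..}) (\<lambda>_. count_space UNIV)) (trajectories x)"
    and "0 \<le> T" and "1 \<le> n"
  shows "measure M {\<omega> \<in> space M. xf n T \<omega> > s} =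
         measure M {\<omega> \<in> space M.
           (\<forall>t\<in>{0..T}. x n t \<omega> > s - \<lfloor>f (T - t)\<rfloor>) \<and>
           (\<forall>j\<in>{0..n - 1}. x (n - j) T \<omega> > s - xf (1 + j) 0 \<omega>)}"
proof -
  interpret prob_space M by fact
  note f = assms(2-5) and T = \<open>0 \<le> T\<close>
  have n: "0 < n" using \<open>1 \<le> n\<close> by simp
  let ?ok = "\<lambda>t y. real_of_int y \<le> f t"
  have pf: "tasep_process ?ok M xf" using assms(6) by (simp add: tasep_with_wall_def)
  have px: "tasep_process (\<lambda>t y. True) M x" using assms(8) by (simp add: tasep_def)
  have xfm[measurable]: "xf m t \<in> measurable M (count_space UNIV)" if "1 \<le> m" "0 \<le> t" for m t
    using pf that by (simp add: tasep_process_def)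
  have xm[measurable]: "x m t \<in> measurable M (count_space UNIV)" if "1 \<le> m" "0 \<le> t" for m t
    using px that by (simp add: tasep_process_def)
  have xcad: "cadlag (\<lambda>t. x n t \<omega>)" if "\<omega> \<in> space M" for \<omega>
    using px that \<open>1 \<le> n\<close> by (simp add: tasep_process_def)
  have xf_order: "AE \<omega> in M. \<forall>m\<ge>1. xf (m + 1) 0 \<omega> < xf m 0 \<omega>"
    using pf unfolding tasep_process_def by blast
  obtain W where W: "waiting_times M W"
    and Wind: "indep_rvs M (PiM {1..} (\<lambda>_. count_space UNIV)) (initial_config xf)
            (PiM ({1..} \<times> UNIV) (\<lambda>_. borel)) (\<lambda>\<omega>. \<lambda>(n, k)\<in>{1..} \<times> UNIV. W n k \<omega>)"
    and Wev: "AE \<omega> in M. tasep_evolution ?ok (\<lambda>n. attempt_times (\<lambda>k. W n k \<omega>)) (\<lambda>n t. xf n t \<omega>)"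
    using pf unfolding tasep_process_def by blast
  obtain V where V: "waiting_times M V"
    and Vev: "AE \<omega> in M. tasep_evolution (\<lambda>t y. True) (\<lambda>n. attempt_times (\<lambda>k. V n k \<omega>)) (\<lambda>n t. x n t \<omega>)"
    using px unfolding tasep_process_def by blast
  define mesh where "mesh N = T / real N" for N :: nat
  define cells where "cells W N \<omega> = attempted_cells n N (mesh N) (\<lambda>m. attempt_times (\<lambda>k. W m k \<omega>))"
    for W :: "nat \<Rightarrow> nat \<Rightarrow> 'a \<Rightarrow> real" and N \<omega>
  \<comment> \<open>The common target of both systems: the sets of indices for which the discrete
    walled run from \<open>c\<close> puts label \<open>n\<close> above \<open>s\<close>. The walled
    system enters with its own cells, the free system with its reflected cells.\<close>
  define F where "F c N = {S. s < run n (\<lambda>i y. y \<le> \<lfloor>f (real (Suc i) * mesh N)\<rfloor>) S c (N * n) n}"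
    for c N
  define R where "R c \<omega> \<longleftrightarrow> (\<forall>t\<in>{0..T}. x n t \<omega> > s - \<lfloor>f (T - t)\<rfloor>) \<and>
      (\<forall>k\<in>{1..n}. x k T \<omega> > s - c (n + 1 - k))" for c \<omega>
  define RN where "RN c N \<omega> \<longleftrightarrow> grid_condition n N T f s c (\<lambda>m t. x m t \<omega>)" for c N \<omega>
  \<comment> \<open>Only labels 1 to \<open>n\<close> are fixed, so countably many such events cover
    the space.\<close>
  define Ev where "Ev c = {\<omega> \<in> space M. \<forall>m\<in>{1..n}. xf m 0 \<omega> = c m}" for c
  let ?I = "PiM {1..} (\<lambda>_. count_space UNIV) :: (nat \<Rightarrow> int) measure"
  define B where "B c = {y \<in> space ?I. \<forall>m\<in>{1..n}. y m = c m}" for c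
  have B: "B c \<in> sets ?I" for c
  proof -
    have [measurable]: "(\<lambda>y. y m) \<in> measurable ?I (count_space UNIV)" if "m \<in> {1..n}" for m
      using that by (intro measurable_component_singleton) auto
    show ?thesis unfolding B_def by measurable
  qed
  have EvB: "Ev c = initial_config xf -` B c \<inter> space M" for c
    by (auto simp: Ev_def B_def initial_config_def space_PiM)
  have Ev: "Ev c \<in> events" for c
    unfolding EvB using B Wind unfolding indep_rvs_def by (intro measurable_sets) auto
  have RN_meas: "{\<omega> \<in> space M. RN c N \<omega>} \<in> events" for c N
  proof -
    have [measurable]: "x n (real i * (T / real N)) \<in> measurable M (count_space UNIV)" for i
      using n T by (intro xm) auto
    have [measurable]: "x k T \<in> measurable M (count_space UNIV)" if "k \<in> {1..n}" for k
      using that T by (intro xm) auto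
    show ?thesis unfolding RN_def grid_condition_def by measurable
  qed
  have cells_meas: "{\<omega> \<in> space M. cells U N \<omega> \<in> G} \<in> events" if "waiting_times M U" for U N G
  proof -
    have "cells U N \<in> measurable M (count_space (Pow {..<N * n}))"
      unfolding cells_def[abs_def] using waiting_times_measurable[OF that]
      by (intro measurable_attempted_cells) auto
    from measurable_sets[OF this, of "G \<inter> Pow {..<N * n}"]
    have "cells U N -` (G \<inter> Pow {..<N * n}) \<inter> space M \<in> events" by auto
    also have "cells U N -` (G \<inter> Pow {..<N * n}) \<inter> space M = {\<omega> \<in> space M. cells U N \<omega> \<in> G}"
      by (auto simp: cells_def attempted_cells_def)
    finally show ?thesis .
  qed
  have R_ev: "\<forall>\<^sub>F N in sequentially. RN c N \<omega> \<longleftrightarrow> R c \<omega>" if "\<omega> \<in> space M" for c \<omega>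
    unfolding RN_def R_def
    by (rule eventually_grid_condition_iff[where x = "\<lambda>m t. x m t \<omega>", OF xcad[OF that] T f(2)])
  have R_meas: "{\<omega> \<in> space M. R c \<omega>} \<in> events" for c
  proof -
    \<comment> \<open>\<open>R\<close> quantifies over uncountably many times. Being the eventual
      value of the measurable conditions \<open>RN\<close>, it is a countable combination of
      them.\<close>
    have "R c \<omega> \<longleftrightarrow> (\<exists>N0. \<forall>N\<ge>N0. RN c N \<omega>)" if w: "\<omega> \<in> space M" for \<omega>
    proof -
      obtain N1 where N1: "\<And>N. N \<ge> N1 \<Longrightarrow> RN c N \<omega> \<longleftrightarrow> R c \<omega>"
        using R_ev[OF w, of c] unfolding eventually_sequentially by blast
      show ?thesis
      proof
        assume "\<exists>N0. \<forall>N\<ge>N0. RN c N \<omega>"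
        then obtain N0 where "\<And>N. N \<ge> N0 \<Longrightarrow> RN c N \<omega>" by blast
        then show "R c \<omega>" using N1[of "max N0 N1"] by simp
      qed (use N1 in blast)
    qed
    then have "{\<omega> \<in> space M. R c \<omega>} = {\<omega> \<in> space M. \<exists>N0. \<forall>N\<ge>N0. RN c N \<omega>}" by blast
    moreover have [measurable]: "Measurable.pred M (RN c N)" for N
      using RN_meas by (simp add: pred_def)
    have "{\<omega> \<in> space M. \<exists>N0. \<forall>N\<ge>N0. RN c N \<omega>} \<in> events" by measurable
    ultimately show ?thesis by simp
  qed
  have conj_meas: "{\<omega> \<in> space M. \<omega> \<in> Ev c \<and> P \<omega>} \<in> events"
    "{\<omega> \<in> space M. \<omega> \<in> Ev c \<and> P \<omega>} = Ev c \<inter> {\<omega> \<in> space M. P \<omega>}"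
    if "{\<omega> \<in> space M. P \<omega>} \<in> events" for c P
  proof -
    show *: "{\<omega> \<in> space M. \<omega> \<in> Ev c \<and> P \<omega>} = Ev c \<inter> {\<omega> \<in> space M. P \<omega>}" by auto
    show "{\<omega> \<in> space M. \<omega> \<in> Ev c \<and> P \<omega>} \<in> events" unfolding * using Ev that by blast
  qed
  have xf_meas: "{\<omega> \<in> space M. s < xf n T \<omega>} \<in> events"
    using xfm[OF \<open>1 \<le> n\<close> T] by measurable
  have main: "prob {\<omega> \<in> space M. \<omega> \<in> Ev c \<and> s < xf n T \<omega>} = prob {\<omega> \<in> space M. \<omega> \<in> Ev c \<and> R c \<omega>}" for c
  proof (cases "packed n c \<and> c 1 \<le> 0")
    case False
    \<comment> \<open>A vector \<open>c\<close> that is not decreasing, or that starts to the right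
      of 0, is almost surely not the initial configuration, so both sides vanish.\<close>
    have "AE \<omega> in M. \<omega> \<notin> Ev c"
      using xf_order assms(7)
    proof eventually_elim
      case (elim \<omega>)
      show ?case
      proof
        assume E: "\<omega> \<in> Ev c"
        have "c 1 = xf 1 0 \<omega>" using E \<open>1 \<le> n\<close> by (auto simp: Ev_def)
        moreover have "packed n c" unfolding packed_def
        proof
          fix m assume m: "m \<in> {1..<n}"
          then have "c m = xf m 0 \<omega>" "c (m + 1) = xf (m + 1) 0 \<omega>" using E by (auto simp: Ev_def)
          with elim(1) m show "c (m + 1) < c m" by auto
        qed
        ultimately show False using False elim(2) by simp
      qed
    qed
    then have null: "Ev c \<in> null_sets M" using Ev by (simp add: AE_iff_null_sets)
    have "prob {\<omega> \<in> space M. \<omega> \<in> Ev c \<and> P \<omega>} = 0" if "{\<omega> \<in> space M. P \<omega>} \<in> events" for P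
    proof -
      have "{\<omega> \<in> space M. \<omega> \<in> Ev c \<and> P \<omega>} \<in> null_sets M"
        by (rule null_sets_subset[OF null conj_meas(1)[OF that]]) auto
      then show ?thesis by (simp add: measure_eq_0_null_sets)
    qed
    from this[OF xf_meas] this[OF R_meas] show ?thesis by simp
  next
    case True
    let ?r = "\<lambda>N p. N * n - Suc p"
    \<comment> \<open>The attempts of the free system are only used in their law: independence of the initial
      configuration is available for the trajectories of \<open>x\<close> but not for its waiting times.\<close>
    have A1: "(\<lambda>N. prob {\<omega> \<in> space M. \<omega> \<in> Ev c \<and> cells W N \<omega> \<in> F c N})
        \<longlonglongrightarrow> prob {\<omega> \<in> space M. \<omega> \<in> Ev c \<and> s < xf n T \<omega>}"
    proof (rule prob_tendsto_of_eventually[OF conj_meas(1)[OF cells_meas[OF W]] conj_meas(1)[OF xf_meas]])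
      show "AE \<omega> in M. \<forall>\<^sub>F N in sequentially.
          \<omega> \<in> {\<omega> \<in> space M. \<omega> \<in> Ev c \<and> cells W N \<omega> \<in> F c N} \<longleftrightarrow>
          \<omega> \<in> {\<omega> \<in> space M. \<omega> \<in> Ev c \<and> s < xf n T \<omega>}"
        using Wev regular_attempts[OF W T, of n] xf_order
      proof eventually_elim
        case (elim \<omega>)
        show ?case
        proof (cases "\<omega> \<in> Ev c")
          case True
          then have c: "\<forall>m\<in>{1..n}. c m = xf m 0 \<omega>" by (simp add: Ev_def)
          have "\<forall>\<^sub>F N in sequentially. run n (\<lambda>i y. y \<le> \<lfloor>f (real (Suc i) * (T / real N))\<rfloor>)
              (attempted_cells n N (T / real N) (\<lambda>m. attempt_times (\<lambda>k. W m k \<omega>))) c (N * n) n = xf n T \<omega>"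
            using elim(2) by (intro eventually_run_eq_wall_path[OF elim(1) n T f(2,3) _ _ elim(3) c]) blast+
          then show ?thesis by eventually_elim (auto simp: F_def cells_def mesh_def)
        qed simp
      qed
    qed
    have A2: "prob {\<omega> \<in> space M. \<omega> \<in> Ev c \<and> cells W N \<omega> \<in> F c N} =
        prob (Ev c) * prob {\<omega> \<in> space M. cells W N \<omega> \<in> F c N}" for N
    proof -
      let ?P = "PiM ({1..} \<times> UNIV) (\<lambda>_. borel) :: (nat \<times> nat \<Rightarrow> real) measure"
      let ?Z = "\<lambda>\<omega>. \<lambda>(n, k)\<in>{1..} \<times> UNIV. W n k \<omega>"
      \<comment> \<open>The cells as a function of the whole family of waiting times: only in this
        form does the independence from the initial configuration apply to them.\<close>
      let ?c = "\<lambda>w. attempted_cells n N (mesh N) (\<lambda>m. attempt_times (\<lambda>k. w (m, k)))"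
      have "?c \<in> measurable ?P (count_space (Pow {..<N * n}))"
        by (intro measurable_attempted_cells measurable_component_singleton) auto
      then have C: "?c -` (F c N \<inter> Pow {..<N * n}) \<inter> space ?P \<in> sets ?P"
        by (rule measurable_sets) auto
      have z1: "?c (?Z \<omega>) = cells W N \<omega>" for \<omega>
        by (auto simp: cells_def attempted_cells_def)
      have z2: "cells W N \<omega> \<subseteq> {..<N * n}" for \<omega>
        by (auto simp: cells_def attempted_cells_def)
      have z3: "?Z \<omega> \<in> space ?P" for \<omega> by (auto simp: space_PiM)
      have "?Z -` (?c -` (F c N \<inter> Pow {..<N * n}) \<inter> space ?P) \<inter> space M =
          {\<omega> \<in> space M. cells W N \<omega> \<in> F c N}"
        by (rule set_eqI) (simp only: vimage_eq Int_iff z1 z2 z3 Pow_iff mem_Collect_eq, blast)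
      then show ?thesis
        using indep_rvs_prob[OF Wind B C, of c] conj_meas(2)[OF cells_meas[OF W]] by (simp add: EvB)
    qed
    have A3: "prob {\<omega> \<in> space M. cells W N \<omega> \<in> F c N} =
        prob {\<omega> \<in> space M. ?r N ` cells V N \<omega> \<in> F c N}" for N
      unfolding cells_def by (rule reflected_attempts_law[OF W V n]) (use T in \<open>simp add: mesh_def\<close>)
    have A4: "(\<lambda>N. prob {\<omega> \<in> space M. ?r N ` cells V N \<omega> \<in> F c N}) \<longlonglongrightarrow> prob {\<omega> \<in> space M. R c \<omega>}"
    proof (rule prob_tendsto_of_eventually[OF _ R_meas])
      show "{\<omega> \<in> space M. ?r N ` cells V N \<omega> \<in> F c N} \<in> events" for N
        using cells_meas[OF V, of N "(\<lambda>S. ?r N ` S) -` F c N"] by simp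
      show "AE \<omega> in M. \<forall>\<^sub>F N in sequentially.
          \<omega> \<in> {\<omega> \<in> space M. ?r N ` cells V N \<omega> \<in> F c N} \<longleftrightarrow> \<omega> \<in> {\<omega> \<in> space M. R c \<omega>}"
        using Vev regular_attempts[OF V T, of n] assms(9)[unfolded step_initial_def] AE_space
      proof eventually_elim
        case (elim \<omega>)
        have "\<forall>\<^sub>F N in sequentially. grid_condition n N T f s c (\<lambda>m t. x m t \<omega>) \<longleftrightarrow>
          s < run n (\<lambda>i y. y \<le> \<lfloor>f (real (Suc i) * (T / real N))\<rfloor>)
            (?r N ` attempted_cells n N (T / real N) (\<lambda>m. attempt_times (\<lambda>k. V m k \<omega>))) c (N * n) n"
          using elim(2) True
          by (intro eventually_grid_condition_iff_run[OF elim(1) n T f(2,1) _ _ elim(3)]) blast+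
        with R_ev[OF elim(4), of c] show ?case
          by eventually_elim (use elim(4) in \<open>auto simp: RN_def F_def cells_def mesh_def\<close>)
      qed
    qed
    \<comment> \<open>Independence of the trajectories is applied to the grid event, which belongs
      to the product sigma-algebra; the factorisation then passes to \<open>R\<close> in the
      limit.\<close>
    have A5: "prob {\<omega> \<in> space M. \<omega> \<in> Ev c \<and> RN c N \<omega>} = prob (Ev c) * prob {\<omega> \<in> space M. RN c N \<omega>}" for N
    proof -
      let ?P = "PiM ({1..} \<times> {0..}) (\<lambda>_. count_space UNIV) :: (nat \<times> real \<Rightarrow> int) measure"
      define C where "C = {y \<in> space ?P. grid_condition n N T f s c (\<lambda>m t. y (m, t))}"
      have C: "C \<in> sets ?P"
      proof -
        have [measurable]: "(\<lambda>y. y (n, real i * (T / real N))) \<in> measurable ?P (count_space UNIV)" for i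
          using n T by (intro measurable_component_singleton) auto
        have [measurable]: "(\<lambda>y. y (k, T)) \<in> measurable ?P (count_space UNIV)" if "k \<in> {1..n}" for k
          using that T by (intro measurable_component_singleton) auto
        show ?thesis unfolding C_def grid_condition_def by measurable
      qed
      have "grid_condition n N T f s c (\<lambda>m t. trajectories x \<omega> (m, t)) \<longleftrightarrow> RN c N \<omega>" for \<omega>
        using n T by (simp add: RN_def grid_condition_def trajectories_def)
      moreover have "trajectories x \<omega> \<in> space ?P" for \<omega>
        by (auto simp: space_PiM trajectories_def)
      ultimately have "trajectories x -` C \<inter> space M = {\<omega> \<in> space M. RN c N \<omega>}"
        by (auto simp: C_def)
      then show ?thesis
        using indep_rvs_prob[OF assms(10) B C, of c] conj_meas(2)[OF RN_meas] by (simp add: EvB)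
    qed
    have "(\<lambda>N. prob {\<omega> \<in> space M. \<omega> \<in> Ev c \<and> RN c N \<omega>}) \<longlonglongrightarrow> prob {\<omega> \<in> space M. \<omega> \<in> Ev c \<and> R c \<omega>}"
    proof (rule prob_tendsto_of_eventually[OF conj_meas(1)[OF RN_meas] conj_meas(1)[OF R_meas]])
      show "AE \<omega> in M. \<forall>\<^sub>F N in sequentially. \<omega> \<in> {\<omega> \<in> space M. \<omega> \<in> Ev c \<and> RN c N \<omega>} \<longleftrightarrow> \<omega> \<in> {\<omega> \<in> space M. \<omega> \<in> Ev c \<and> R c \<omega>}"
        using AE_space
      proof eventually_elim
        case (elim \<omega>)
        show ?case using R_ev[OF elim, of c] by eventually_elim auto
      qed
    qed
    moreover have "(\<lambda>N. prob {\<omega> \<in> space M. RN c N \<omega>}) \<longlonglongrightarrow> prob {\<omega> \<in> space M. R c \<omega>}"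
    proof (rule prob_tendsto_of_eventually[OF RN_meas R_meas])
      show "AE \<omega> in M. \<forall>\<^sub>F N in sequentially. \<omega> \<in> {\<omega> \<in> space M. RN c N \<omega>} \<longleftrightarrow> \<omega> \<in> {\<omega> \<in> space M. R c \<omega>}"
        using AE_space
      proof eventually_elim
        case (elim \<omega>)
        show ?case using R_ev[OF elim, of c] by eventually_elim auto
      qed
    qed
    then have "(\<lambda>N. prob (Ev c) * prob {\<omega> \<in> space M. RN c N \<omega>}) \<longlonglongrightarrow> prob (Ev c) * prob {\<omega> \<in> space M. R c \<omega>}"
      by (rule tendsto_mult_left)
    ultimately have RR: "prob {\<omega> \<in> space M. \<omega> \<in> Ev c \<and> R c \<omega>} = prob (Ev c) * prob {\<omega> \<in> space M. R c \<omega>}"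
      unfolding A5 by (rule LIMSEQ_unique)
    \<comment> \<open>By \<open>A1\<close> and \<open>A2\<close> this same sequence tends to the
      walled probability on \<open>Ev c\<close>; by \<open>A3\<close> and \<open>A4\<close> it tends
      to the product, which \<open>RR\<close> identifies with the probability of the right-hand
      event on \<open>Ev c\<close>.\<close>
    have "(\<lambda>N. prob (Ev c) * prob {\<omega> \<in> space M. cells W N \<omega> \<in> F c N}) \<longlonglongrightarrow>
        prob (Ev c) * prob {\<omega> \<in> space M. R c \<omega>}"
      unfolding A3 by (rule tendsto_mult_left[OF A4])
    with A1 show ?thesis unfolding A2 RR by (rule LIMSEQ_unique)
  qed
  \<comment> \<open>Integer lists form a countable type, in contrast to full configurations, so the
    fixed-\<open>c\<close> identities can be summed over the values of \<open>L\<close>. Entry m - 1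
    of the list belongs to label m.\<close>
  define L where "L \<omega> = map (\<lambda>m. xf m 0 \<omega>) [1..<Suc n]" for \<omega>
  define Q where "Q \<omega> \<longleftrightarrow> (\<forall>t\<in>{0..T}. x n t \<omega> > s - \<lfloor>f (T - t)\<rfloor>) \<and>
      (\<forall>j\<in>{0..n - 1}. x (n - j) T \<omega> > s - xf (1 + j) 0 \<omega>)" for \<omega>
  have QR: "Q \<omega> \<longleftrightarrow> R c \<omega>" if "\<omega> \<in> Ev c" for c \<omega>
  proof -
    have "(\<forall>j\<in>{0..n - 1}. x (n - j) T \<omega> > s - xf (1 + j) 0 \<omega>) \<longleftrightarrow>
        (\<forall>k\<in>{1..n}. x k T \<omega> > s - c (n + 1 - k))"
    proof (intro iffI ballI)
      fix k assume *: "\<forall>j\<in>{0..n - 1}. x (n - j) T \<omega> > s - xf (1 + j) 0 \<omega>" and k: "k \<in> {1..n}"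
      then have "n - k \<in> {0..n - 1}" "n - (n - k) = k" "1 + (n - k) = n + 1 - k" by auto
      then have "x k T \<omega> > s - xf (n + 1 - k) 0 \<omega>" using * by metis
      moreover have "n + 1 - k \<in> {1..n}" using k by auto
      ultimately show "x k T \<omega> > s - c (n + 1 - k)" using that by (simp add: Ev_def)
    next
      fix j assume *: "\<forall>k\<in>{1..n}. x k T \<omega> > s - c (n + 1 - k)" and j: "j \<in> {0..n - 1}"
      have "n - j \<in> {1..n}" "n + 1 - (n - j) = 1 + j" "1 + j \<in> {1..n}" using j n by auto
      moreover from this have "xf (1 + j) 0 \<omega> = c (1 + j)" using that unfolding Ev_def by blast
      ultimately show "x (n - j) T \<omega> > s - xf (1 + j) 0 \<omega>" using * by metis
    qed
    then show ?thesis by (simp add: Q_def R_def)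
  qed
  have part: "{\<omega> \<in> space M. L \<omega> = l \<and> P \<omega>} =
      (if length l = n then {\<omega> \<in> space M. \<omega> \<in> Ev (\<lambda>m. l ! (m - 1)) \<and> P \<omega>} else {})" for l P
  proof -
    have "L \<omega> = l \<longleftrightarrow> length l = n \<and> (\<forall>m\<in>{1..n}. xf m 0 \<omega> = l ! (m - 1))" for \<omega>
    proof -
      have "(\<forall>i<n. xf (Suc i) 0 \<omega> = l ! i) \<longleftrightarrow> (\<forall>m\<in>{1..n}. xf m 0 \<omega> = l ! (m - 1))"
      proof (intro iffI ballI allI impI)
        fix m assume "\<forall>i<n. xf (Suc i) 0 \<omega> = l ! i" "m \<in> {1..n}"
        then show "xf m 0 \<omega> = l ! (m - 1)" by (cases m) auto
      next
        fix i assume "\<forall>m\<in>{1..n}. xf m 0 \<omega> = l ! (m - 1)" "i < n"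
        then show "xf (Suc i) 0 \<omega> = l ! i" by (auto dest!: bspec[of _ _ "Suc i"])
      qed
      then show ?thesis unfolding L_def list_eq_iff_nth_eq by (auto simp del: upt_Suc)
    qed
    then show ?thesis by (auto simp: Ev_def)
  qed
  have parts: "{\<omega> \<in> space M. \<omega> \<in> Ev c \<and> Q \<omega>} = {\<omega> \<in> space M. \<omega> \<in> Ev c \<and> R c \<omega>}" for c
    using QR by blast
  have "prob {\<omega> \<in> space M. s < xf n T \<omega>} = prob {\<omega> \<in> space M. Q \<omega>}"
  proof (rule prob_eq_by_countable_partition[where L = L])
    show "{\<omega> \<in> space M. L \<omega> = l \<and> s < xf n T \<omega>} \<in> events" for l
      unfolding part using conj_meas(1)[OF xf_meas] by simp
    show "{\<omega> \<in> space M. L \<omega> = l \<and> Q \<omega>} \<in> events" for l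
      unfolding part parts using conj_meas(1)[OF R_meas] by simp
    show "prob {\<omega> \<in> space M. L \<omega> = l \<and> s < xf n T \<omega>} = prob {\<omega> \<in> space M. L \<omega> = l \<and> Q \<omega>}" for l
      unfolding part parts using main by simp
  qed
  then show ?thesis by (simp add: Q_def)
qed

end
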